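(* For every completely regular frame $L$, the $\sigma$-frame $\mathrm{Coz}_c[L]=\{\mathrm{coz}(\alpha)\mid \alpha\in\mathcal C_c(L)\}$ (with the order inherited from $L$) is an Alexandroff algebra.
   Context: Let $L$ be a frame with top $\top$ and bottom $\bot$. The frame of reals $\mathcal L(\mathbb R)$ is generated by pairs $(p,q)$, $p,q\in\mathbb Q$, subject to: (R1) $(p,q)\wedge(r,s)=(p\vee r,q\wedge s)$; (R2) $(p,q)\vee(r,s)=(p,s)$ whenever $p\le r<q\le s$; (R3) $(p,q)=\bigvee\{(r,s)\mid p<r<s<q\}$; (R4) $\top=\bigvee\{(p,q)\mid p,q\in\mathbb Q\}$. $\mathcal R(L)$ is the set of frame homomorphisms $\mathcal L(\mathbb R)\to L$; it is an $f$-ring with operations, for $\diamond\in\{+,\cdot,\wedge,\vee\}$, $(\alpha\diamond\beta)(p,q)=\bigvee\{\alpha(r,s)\wedge\beta(u,v)\mid \langle r,s\rangle\diamond\langle u,v\rangle\subseteq\langle p,q\rangle\}$, where $\langle p,q\rangle=\{t\in\mathbb R\mid p<t<q\}$. For $r\in\mathbb R$, the constant $\mathbf r\in\mathcal R(L)$ satisfies $\mathbf r(p,q)=\top$ if $p<r<q$ and $\bot$ otherwise; $\alpha-r$ means $\alpha-\mathbf r$. Put $(p,-)=\bigvee_{r,s>p}(r,s)$ and $(-,q)=\bigvee_{r,s<q}(r,s)$ (with $r,s\in\mathbb Q$). The cozero element of $\alpha$ is $\mathrm{coz}(\alpha)=\alpha(-,0)\vee\alpha(0,-)$. Put $R_\alpha=\{r\in\mathbb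 R\mid \mathrm{coz}(\alpha-r)\ne\top\}$ and $\mathcal C_c(L)=\{\alpha\in\mathcal R(L)\mid R_\alpha\text{ is countable}\}$ (countable includes finite). $L$ is completely regular iff every element of $L$ is the join of elements of the form $\mathrm{coz}(\alpha)$, $\alpha\in\mathcal R(L)$. A $\sigma$-frame is a distributive lattice $M$ in which every countable subset has a join and $a\wedge\bigvee S=\bigvee_{s\in S}(a\wedge s)$ for all $a\in M$ and countable $S\subseteq M$. A bounded lattice $M$ is normal if whenever $a,b\in M$ satisfy $a\vee b=\top$ there exist $u,v\in M$ with $a\vee u=\top=v\vee b$ and $u\wedge v=\bot$. An Alexandroff algebra is a normal $\sigma$-lattice $M$ (bounded lattice with countable joins) such that for every $a\in M$ there is a sequence of pairs $(a_n,b_n)_{n=1}^\infty$ of elements of $M$ with $b_n\vee a=\top$ and $b_n\wedge a_n=\bot$ for every $n$, and $\bigvee_{n=1}^\infty a_n=a$. *)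

theory Defs
  imports
    Complex_Main
    "HOL-Library.FSet"
    "HOL-Library.Countable_Set"
    "HOL-Algebra.Lattice"
begin

(* These names would hide the type-class constant "top"; the indexed notation is unaffected. *)
hide_const (open) Order.top Order.bottom

section \<open>Frames\<close>

text \<open>The library class \<open>complete_distrib_lattice\<close> demands complete distributivity, so it is too
  strong for frames.\<close>

class frame = complete_lattice +
  assumes inf_Sup: "inf a (Sup S) = Sup ((\<lambda>s. inf a s) ` S)"

definition frame_hom :: "('a::frame \<Rightarrow> 'b::frame) \<Rightarrow> bool" where
  "frame_hom h \<longleftrightarrow> h top = top \<and> (\<forall>x y. h (inf x y) = inf (h x) (h y)) \<and> (\<forall>S. h (Sup S) = Sup (h ` S))"

lemma frame_homD:
  assumes "frame_hom h"
  shows "h top = top" "h (inf x y) = inf (h x) (h y)" "h (Sup S) = Sup (h ` S)"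
  using assms by (auto simp: frame_hom_def)

lemma frame_hom_sup:
  assumes "frame_hom h"
  shows "h (sup x y) = sup (h x) (h y)"
  using frame_homD(3)[OF assms, of "{x, y}"] by simp

lemma frame_hom_mono:
  assumes "frame_hom h" "x \<le> y"
  shows "h x \<le> h y"
  using frame_homD(2)[OF assms(1), of x y] assms(2) by (metis inf.absorb_iff1)

lemma frame_hom_Inf_finite:
  assumes "frame_hom h" "finite A"
  shows "h (Inf A) = Inf (h ` A)"
  using assms(2) by induction (simp_all add: frame_homD[OF assms(1)])

lemma frame_hom_comp:
  assumes "frame_hom g" "frame_hom h"
  shows "frame_hom (\<lambda>x. g (h x))"
  using assms by (auto simp: frame_hom_def image_image)

section \<open>Free frames\<close>

text \<open>The free frame on a set of generators: the finite meets of generators form the free bounded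
  meet-semilattice (finite sets ordered by reverse inclusion), and the free frame is the frame of
  its down-sets.\<close>

typedef 'g free_frame = "{U :: 'g fset set. \<forall>A\<in>U. \<forall>B. A |\<subseteq>| B \<longrightarrow> B \<in> U}"
  by auto

setup_lifting type_definition_free_frame

instantiation free_frame :: (type) frame
begin

lift_definition less_eq_free_frame :: "'a free_frame \<Rightarrow> 'a free_frame \<Rightarrow> bool" is "(\<subseteq>)" .
lift_definition less_free_frame :: "'a free_frame \<Rightarrow> 'a free_frame \<Rightarrow> bool" is "(\<subset>)" .
lift_definition inf_free_frame :: "'a free_frame \<Rightarrow> 'a free_frame \<Rightarrow> 'a free_frame" is "(\<inter>)" by auto
lift_definition sup_free_frame :: "'a free_frame \<Rightarrow> 'a free_frame \<Rightarrow> 'a free_frame" is "(\<union>)" by auto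
lift_definition top_free_frame :: "'a free_frame" is UNIV by auto
lift_definition bot_free_frame :: "'a free_frame" is "{}" by auto
lift_definition Inf_free_frame :: "'a free_frame set \<Rightarrow> 'a free_frame" is "\<lambda>S. \<Inter>S" by auto
lift_definition Sup_free_frame :: "'a free_frame set \<Rightarrow> 'a free_frame" is "\<lambda>S. \<Union>S" by blast

instance
proof
  fix a b c :: "'a free_frame" and S :: "'a free_frame set"
  show "(a < b) = (a \<le> b \<and> \<not> b \<le> a)" by transfer auto
  show "a \<le> a" by transfer auto
  show "a \<le> b \<Longrightarrow> b \<le> c \<Longrightarrow> a \<le> c" by transfer auto
  show "a \<le> b \<Longrightarrow> b \<le> a \<Longrightarrow> a = b" by transfer auto
  show "inf a b \<le> a" "inf a b \<le> b" by (transfer, simp)+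
  show "a \<le> b \<Longrightarrow> a \<le> c \<Longrightarrow> a \<le> inf b c" by transfer auto
  show "a \<le> sup a b" "b \<le> sup a b" by (transfer, simp)+
  show "b \<le> a \<Longrightarrow> c \<le> a \<Longrightarrow> sup b c \<le> a" by transfer auto
  show "a \<in> S \<Longrightarrow> Inf S \<le> a" by transfer (rule Inter_lower)
  show "(\<And>x. x \<in> S \<Longrightarrow> a \<le> x) \<Longrightarrow> a \<le> Inf S"
    by (simp add: less_eq_free_frame.rep_eq Inf_free_frame.rep_eq le_INF_iff)
  show "a \<in> S \<Longrightarrow> a \<le> Sup S" by transfer (rule Union_upper)
  show "(\<And>x. x \<in> S \<Longrightarrow> x \<le> a) \<Longrightarrow> Sup S \<le> a"
    by (simp add: less_eq_free_frame.rep_eq Sup_free_frame.rep_eq SUP_le_iff)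
  show "Inf {} = (top :: 'a free_frame)" by transfer simp
  show "Sup {} = (bot :: 'a free_frame)" by transfer simp
  show "inf a (Sup S) = Sup ((\<lambda>s. inf a s) ` S)"
    by transfer (rule Int_Union)
qed

end

lift_definition free_gen :: "'g \<Rightarrow> 'g free_frame" is "\<lambda>g. {A. g |\<in>| A}" by auto

lemma Rep_free_frame_up:
  "A \<in> Rep_free_frame u \<Longrightarrow> A |\<subseteq>| B \<Longrightarrow> B \<in> Rep_free_frame u"
  using Rep_free_frame[of u] by auto

lemma free_frame_expand:
  "u = Sup ((\<lambda>A. Inf (free_gen ` fset A)) ` Rep_free_frame u)"
proof (rule antisym)
  show "u \<le> Sup ((\<lambda>A. Inf (free_gen ` fset A)) ` Rep_free_frame u)"
    unfolding less_eq_free_frame.rep_eq Sup_free_frame.rep_eq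
    by (auto simp: Inf_free_frame.rep_eq free_gen.rep_eq)
  show "Sup ((\<lambda>A. Inf (free_gen ` fset A)) ` Rep_free_frame u) \<le> u"
    unfolding less_eq_free_frame.rep_eq Sup_free_frame.rep_eq
  proof clarsimp
    fix A B
    assume "A \<in> Rep_free_frame u" "B \<in> Rep_free_frame (Inf (free_gen ` fset A))"
    then have "A |\<subseteq>| B"
      by (auto simp: Inf_free_frame.rep_eq free_gen.rep_eq)
    with \<open>A \<in> Rep_free_frame u\<close> show "B \<in> Rep_free_frame u"
      by (rule Rep_free_frame_up)
  qed
qed

definition free_ext :: "('g \<Rightarrow> 'a::frame) \<Rightarrow> 'g free_frame \<Rightarrow> 'a" where
  "free_ext f u = Sup ((\<lambda>A. Inf (f ` fset A)) ` Rep_free_frame u)"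

lemma free_ext_gen: "free_ext f (free_gen g) = f g"
  unfolding free_ext_def free_gen.rep_eq
proof (rule antisym)
  show "Sup ((\<lambda>A. Inf (f ` fset A)) ` {A. g |\<in>| A}) \<le> f g"
    by (auto intro!: SUP_least INF_lower)
  show "f g \<le> Sup ((\<lambda>A. Inf (f ` fset A)) ` {A. g |\<in>| A})"
    by (rule SUP_upper2[where i = "{|g|}"]) auto
qed

lemma frame_hom_free_ext: "frame_hom (free_ext f)"
  unfolding frame_hom_def
proof (intro conjI allI)
  show "free_ext f top = top"
    unfolding free_ext_def top_free_frame.rep_eq
    by (rule top_le, rule SUP_upper2[where i = "{||}"]) auto
  show "free_ext f (Sup S) = Sup (free_ext f ` S)" for S
    unfolding free_ext_def Sup_free_frame.rep_eq by (simp add: SUP_UNION)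
  fix u v :: "'a free_frame"
  show "free_ext f (inf u v) = inf (free_ext f u) (free_ext f v)"
  proof (rule antisym)
    show "free_ext f (inf u v) \<le> inf (free_ext f u) (free_ext f v)"
      unfolding free_ext_def inf_free_frame.rep_eq by (intro le_infI SUP_subset_mono) auto
    have *: "inf (Inf (f ` fset A)) (Inf (f ` fset B)) \<le> free_ext f (inf u v)"
      if A: "A \<in> Rep_free_frame u" and B: "B \<in> Rep_free_frame v" for A B
    proof -
      have "A |\<union>| B \<in> Rep_free_frame u" "A |\<union>| B \<in> Rep_free_frame v"
        using Rep_free_frame_up[OF A] Rep_free_frame_up[OF B] by simp_all
      then have "Inf (f ` fset (A |\<union>| B)) \<le> free_ext f (inf u v)"
        unfolding free_ext_def inf_free_frame.rep_eq by (intro SUP_upper) auto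
      then show ?thesis
        by (simp add: image_Un Inf_union_distrib)
    qed
    have **: "inf (free_ext f u) (Inf (f ` fset B)) \<le> free_ext f (inf u v)"
      if B: "B \<in> Rep_free_frame v" for B
    proof -
      have "inf (Inf (f ` fset B)) (free_ext f u) =
          Sup ((\<lambda>A. inf (Inf (f ` fset B)) (Inf (f ` fset A))) ` Rep_free_frame u)"
        unfolding free_ext_def[of f u] inf_Sup by (simp add: image_image)
      also have "\<dots> \<le> free_ext f (inf u v)"
        by (rule SUP_least) (use *[OF _ B] in \<open>simp add: inf.commute\<close>)
      finally show ?thesis
        by (simp add: inf.commute)
    qed
    have "inf (free_ext f u) (free_ext f v) =
        Sup ((\<lambda>B. inf (free_ext f u) (Inf (f ` fset B))) ` Rep_free_frame v)"
      unfolding free_ext_def[of f v] inf_Sup by (simp add: image_image)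
    also have "\<dots> \<le> free_ext f (inf u v)"
      by (rule SUP_least) (rule **)
    finally show "inf (free_ext f u) (free_ext f v) \<le> free_ext f (inf u v)" .
  qed
qed

lemma frame_hom_free_expand:
  assumes "frame_hom k"
  shows "k u = free_ext (\<lambda>x. k (free_gen x)) u"
proof -
  have "k u = k (Sup ((\<lambda>A. Inf (free_gen ` fset A)) ` Rep_free_frame u))"
    by (rule arg_cong[OF free_frame_expand])
  also have "\<dots> = Sup ((\<lambda>A. k (Inf (free_gen ` fset A))) ` Rep_free_frame u)"
    unfolding frame_homD(3)[OF assms] image_image ..
  also have "\<dots> = free_ext (\<lambda>x. k (free_gen x)) u"
    unfolding free_ext_def
    by (rule arg_cong[where f = Sup], rule image_cong)
      (simp_all add: frame_hom_Inf_finite[OF assms] image_image)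
  finally show ?thesis .
qed

lemma frame_hom_free_eqI:
  assumes "frame_hom g" "frame_hom h" "\<And>x. g (free_gen x) = h (free_gen x)"
  shows "g u = h u"
  unfolding frame_hom_free_expand[OF assms(1), of u] frame_hom_free_expand[OF assms(2), of u]
  by (rule arg_cong[where f = "\<lambda>f. free_ext f u"]) (use assms(3) in auto)

section \<open>The frame of reals\<close>

text \<open>The defining relations (R1)--(R4), as pairs of elements to be identified, for an arbitrary
  assignment \<open>g\<close> of frame elements to the generators \<open>(p, q)\<close>.\<close>

definition real_relations :: "(rat \<Rightarrow> rat \<Rightarrow> 'a::frame) \<Rightarrow> ('a \<times> 'a) set" where
  "real_relations g =
     {(inf (g p q) (g r s), g (max p r) (min q s)) | p q r s. True}
   \<union> {(sup (g p q) (g r s), g p s) | p q r s. p \<le> r \<and> r < q \<and> q \<le> s}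
   \<union> {(g p q, Sup {g r s | r s. p < r \<and> r < s \<and> s < q}) | p q. True}
   \<union> {(top, Sup {g p q | p q. True})}"

text \<open>The quotient of a frame by the least frame congruence containing a relation \<open>R\<close> is realised,
  as usual, by the frame of its \<open>R\<close>-saturated elements.\<close>

definition saturated :: "('a::frame \<times> 'a) set \<Rightarrow> 'a \<Rightarrow> bool" where
  "saturated R s \<longleftrightarrow> (\<forall>(u, v)\<in>R. \<forall>w. inf u w \<le> s \<longleftrightarrow> inf v w \<le> s)"

lemma saturatedD: "saturated R s \<Longrightarrow> (u, v) \<in> R \<Longrightarrow> inf u w \<le> s \<longleftrightarrow> inf v w \<le> s"
  unfolding saturated_def by blast

lemma saturated_Inf: "(\<And>s. s \<in> S \<Longrightarrow> saturated R s) \<Longrightarrow> saturated R (Inf S)"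
  by (simp add: saturated_def le_Inf_iff split: prod.splits) blast

definition saturation :: "('a::frame \<times> 'a) set \<Rightarrow> 'a \<Rightarrow> 'a" where
  "saturation R u = Inf {s. saturated R s \<and> u \<le> s}"

lemma saturated_saturation: "saturated R (saturation R u)"
  unfolding saturation_def by (rule saturated_Inf) auto

lemma saturation_upper: "u \<le> saturation R u"
  unfolding saturation_def by (auto intro: Inf_greatest)

lemma saturation_le_iff: "saturated R s \<Longrightarrow> saturation R u \<le> s \<longleftrightarrow> u \<le> s"
  using Inf_lower[of s "{s. saturated R s \<and> u \<le> s}"] saturation_upper[of u R]
  unfolding saturation_def[symmetric] by (auto intro: order_trans)

lemma saturation_id: "saturated R s \<Longrightarrow> saturation R s = s"
  by (simp add: antisym saturation_le_iff saturation_upper)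

lemma saturation_mono: "u \<le> v \<Longrightarrow> saturation R u \<le> saturation R v"
  by (simp only: saturation_le_iff[OF saturated_saturation] order_trans[OF _ saturation_upper])

lemma le_heyting_iff: "w \<le> Sup {x. inf (v::'a::frame) x \<le> s} \<longleftrightarrow> inf v w \<le> s"
proof
  assume "w \<le> Sup {x. inf v x \<le> s}"
  then have "inf v w \<le> inf v (Sup {x. inf v x \<le> s})"
    by (rule inf_mono[OF order_refl])
  also have "\<dots> \<le> s"
    unfolding inf_Sup by (auto intro: SUP_least)
  finally show "inf v w \<le> s" .
qed (auto intro: Sup_upper)

lemma saturated_heyting:
  assumes "saturated R s"
  shows "saturated R (Sup {x. inf v x \<le> s})"
  using assms unfolding saturated_def le_heyting_iff
  by (auto simp: inf.left_commute[of v])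

lemma saturation_inf: "saturation R (inf u v) = inf (saturation R u) (saturation R v)"
proof (rule antisym)
  show "saturation R (inf u v) \<le> inf (saturation R u) (saturation R v)"
    by (simp add: saturation_mono)
  have *: "inf y (saturation R x) \<le> saturation R (inf u v)" if "inf y x \<le> saturation R (inf u v)" for x y
  proof -
    have "x \<le> Sup {z. inf y z \<le> saturation R (inf u v)}"
      unfolding le_heyting_iff by (rule that)
    then have "saturation R x \<le> Sup {z. inf y z \<le> saturation R (inf u v)}"
      by (simp only: saturation_le_iff[OF saturated_heyting[OF saturated_saturation]])
    then show ?thesis
      unfolding le_heyting_iff .
  qed
  have "inf v (saturation R u) \<le> saturation R (inf u v)"
    by (rule *) (simp add: inf.commute saturation_upper)
  then have "inf (saturation R u) (saturation R v) \<le> saturation R (inf u v)"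
    by (intro *) (simp add: inf.commute)
  then show "inf (saturation R u) (saturation R v) \<le> saturation R (inf u v)" .
qed

abbreviation free_real_relations :: "((rat \<times> rat) free_frame \<times> (rat \<times> rat) free_frame) set" where
  "free_real_relations \<equiv> real_relations (\<lambda>p q. free_gen (p, q))"

typedef frame_of_reals = "{s. saturated free_real_relations s}"
  using saturated_saturation by auto

setup_lifting type_definition_frame_of_reals

lift_definition real_quot :: "(rat \<times> rat) free_frame \<Rightarrow> frame_of_reals"
  is "saturation free_real_relations"
  by (rule saturated_saturation)

definition real_gen :: "rat \<Rightarrow> rat \<Rightarrow> frame_of_reals" where
  "real_gen p q = real_quot (free_gen (p, q))"

instantiation frame_of_reals :: frame
begin

lift_definition less_eq_frame_of_reals :: "frame_of_reals \<Rightarrow> frame_of_reals \<Rightarrow> bool" is "(\<le>)" .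
lift_definition less_frame_of_reals :: "frame_of_reals \<Rightarrow> frame_of_reals \<Rightarrow> bool" is "(<)" .
lift_definition inf_frame_of_reals :: "frame_of_reals \<Rightarrow> frame_of_reals \<Rightarrow> frame_of_reals" is inf
  by (auto simp: saturated_def)
lift_definition top_frame_of_reals :: frame_of_reals is top
  by (auto simp: saturated_def)
lift_definition Inf_frame_of_reals :: "frame_of_reals set \<Rightarrow> frame_of_reals" is Inf
  by (rule saturated_Inf)
lift_definition sup_frame_of_reals :: "frame_of_reals \<Rightarrow> frame_of_reals \<Rightarrow> frame_of_reals"
  is "\<lambda>u v. saturation free_real_relations (sup u v)"
  by (rule saturated_saturation)
lift_definition bot_frame_of_reals :: frame_of_reals is "saturation free_real_relations bot"
  by (rule saturated_saturation)
lift_definition Sup_frame_of_reals :: "frame_of_reals set \<Rightarrow> frame_of_reals"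
  is "\<lambda>S. saturation free_real_relations (Sup S)"
  by (rule saturated_saturation)

instance
proof
  fix a b c :: frame_of_reals and S :: "frame_of_reals set"
  show "(a < b) = (a \<le> b \<and> \<not> b \<le> a)" by transfer auto
  show "a \<le> a" by transfer auto
  show "a \<le> b \<Longrightarrow> b \<le> c \<Longrightarrow> a \<le> c" by transfer auto
  show "a \<le> b \<Longrightarrow> b \<le> a \<Longrightarrow> a = b" by transfer auto
  show "inf a b \<le> a" "inf a b \<le> b" by (transfer, simp)+
  show "a \<le> b \<Longrightarrow> a \<le> c \<Longrightarrow> a \<le> inf b c" by transfer auto
  show "a \<le> sup a b" "b \<le> sup a b"
    by (transfer, rule order_trans[OF _ saturation_upper], simp)+
  show "b \<le> a \<Longrightarrow> c \<le> a \<Longrightarrow> sup b c \<le> a" by transfer (simp add: saturation_le_iff)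
  show "a \<in> S \<Longrightarrow> Inf S \<le> a" by transfer (auto intro: Inf_lower)
  show "(\<And>x. x \<in> S \<Longrightarrow> a \<le> x) \<Longrightarrow> a \<le> Inf S"
    by (simp add: less_eq_frame_of_reals.rep_eq Inf_frame_of_reals.rep_eq le_INF_iff)
  show "a \<in> S \<Longrightarrow> a \<le> Sup S" by transfer (rule order_trans[OF Sup_upper saturation_upper])
  show "(\<And>x. x \<in> S \<Longrightarrow> x \<le> a) \<Longrightarrow> Sup S \<le> a"
    using Rep_frame_of_reals[of a]
    by (simp add: less_eq_frame_of_reals.rep_eq Sup_frame_of_reals.rep_eq saturation_le_iff SUP_le_iff)
  show "Inf {} = (top :: frame_of_reals)" by transfer auto
  show "Sup {} = (bot :: frame_of_reals)" by transfer auto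
  show "inf a (Sup S) = Sup ((\<lambda>s. inf a s) ` S)"
    by transfer (metis inf_Sup saturation_id saturation_inf)
qed

end

lemma frame_hom_real_quot: "frame_hom real_quot"
  unfolding frame_hom_def
proof (intro conjI allI)
  show "real_quot top = top"
    by transfer (simp add: top_le saturation_upper)
  show "real_quot (inf u v) = inf (real_quot u) (real_quot v)" for u v
    by transfer (rule saturation_inf)
  show "real_quot (Sup S) = Sup (real_quot ` S)" for S
  proof (transfer fixing: S, rule antisym)
    let ?c = "saturation free_real_relations"
    show "?c (Sup S) \<le> ?c (Sup (?c ` S))"
      by (rule saturation_mono) (auto intro!: Sup_least intro: SUP_upper2 saturation_upper)
    show "?c (Sup (?c ` S)) \<le> ?c (Sup S)"
      by (auto simp: saturation_le_iff saturated_saturation intro!: SUP_least saturation_mono Sup_upper)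
  qed
qed

lemma real_relations_hom:
  assumes "frame_hom h" "(u, v) \<in> real_relations g"
  shows "(h u, h v) \<in> real_relations (\<lambda>p q. h (g p q))"
proof -
  have 1: "h ` {g r s | r s. P r s} = {h (g r s) | r s. P r s}" for P
    by auto
  note hom = frame_homD[OF assms(1)] frame_hom_sup[OF assms(1)]
  consider (R1) p q r s where "u = inf (g p q) (g r s)" "v = g (max p r) (min q s)"
    | (R2) p q r s where "u = sup (g p q) (g r s)" "v = g p s" "p \<le> r" "r < q" "q \<le> s"
    | (R3) p q where "u = g p q" "v = Sup {g r s | r s. p < r \<and> r < s \<and> s < q}"
    | (R4) "u = top" "v = Sup {g p q | p q. True}"
    using assms(2) unfolding real_relations_def by blast
  then show ?thesis
  proof cases
    case R1
    then show ?thesis unfolding real_relations_def R1 hom by blast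
  next
    case R2
    then show ?thesis unfolding real_relations_def R2(1,2) hom by blast
  next
    case R3
    then show ?thesis unfolding real_relations_def R3 hom 1 by blast
  next
    case R4
    then show ?thesis unfolding real_relations_def R4 hom 1 by blast
  qed
qed

text \<open>The generators of \<^typ>\<open>frame_of_reals\<close> satisfy (R1)--(R4), and universally so.\<close>

lemma real_gen_relations:
  "\<forall>(u, v)\<in>real_relations real_gen. u = v"
proof -
  have eq: "real_quot u = real_quot v" if "(u, v) \<in> free_real_relations" for u v
  proof -
    have "u \<le> s \<longleftrightarrow> v \<le> s" if "saturated free_real_relations s" for s
      using saturatedD[OF that \<open>(u, v) \<in> free_real_relations\<close>, of top] by simp
    then have "{s. saturated free_real_relations s \<and> u \<le> s} = {s. saturated free_real_relations s \<and> v \<le> s}"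
      by blast
    then show ?thesis
      by transfer (simp add: saturation_def)
  qed
  have img: "real_quot ` {free_gen (r, s) | r s. P r s} = {real_gen r s | r s. P r s}" for P
    by (auto simp: real_gen_def)
  note hom = frame_homD[OF frame_hom_real_quot] frame_hom_sup[OF frame_hom_real_quot]
  have R1: "inf (real_gen p q) (real_gen r s) = real_gen (max p r) (min q s)" for p q r s
    unfolding real_gen_def hom[symmetric] by (rule eq) (auto simp: real_relations_def)
  have R2: "sup (real_gen p q) (real_gen r s) = real_gen p s" if "p \<le> r" "r < q" "q \<le> s" for p q r s
    unfolding real_gen_def hom[symmetric] by (rule eq) (use that in \<open>auto simp: real_relations_def\<close>)
  have R3: "real_gen p q = Sup {real_gen r s | r s. p < r \<and> r < s \<and> s < q}" for p q
    unfolding img[symmetric] unfolding real_gen_def hom[symmetric]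
    by (rule eq) (auto simp: real_relations_def)
  have R4: "top = Sup {real_gen p q | p q. True}"
    unfolding img[symmetric] unfolding hom[symmetric]
    by (rule eq) (auto simp: real_relations_def)
  show ?thesis
    unfolding real_relations_def using R1 R2 R3[symmetric] R4 by auto
qed

lemma real_universal:
  fixes f :: "rat \<Rightarrow> rat \<Rightarrow> 'a::frame"
  assumes "\<forall>(u, v)\<in>real_relations f. u = v"
  shows "\<exists>!h. frame_hom h \<and> (\<forall>p q. h (real_gen p q) = f p q)"
proof (rule ex_ex1I)
  define k where "k = free_ext (\<lambda>(p, q). f p q)"
  have k: "frame_hom k"
    unfolding k_def by (rule frame_hom_free_ext)
  have k_gen: "k (free_gen (p, q)) = f p q" for p q
    by (simp add: k_def free_ext_gen)
  have k_rel: "k u = k v" if "(u, v) \<in> free_real_relations" for u v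
    using real_relations_hom[OF k that] assms by (auto simp: k_gen)
  have k_le: "u \<le> Sup {x. k x \<le> a} \<longleftrightarrow> k u \<le> a" for u a
  proof
    assume "u \<le> Sup {x. k x \<le> a}"
    then have "k u \<le> k (Sup {x. k x \<le> a})"
      by (rule frame_hom_mono[OF k])
    also have "\<dots> \<le> a"
      unfolding frame_homD(3)[OF k] by (auto intro: SUP_least)
    finally show "k u \<le> a" .
  qed (auto intro: Sup_upper)
  have sat: "saturated free_real_relations (Sup {x. k x \<le> a})" for a
    unfolding saturated_def k_le frame_homD(2)[OF k] using k_rel by fastforce
  have k_saturation: "k (saturation free_real_relations u) = k u" for u
  proof (rule antisym)
    have "u \<le> Sup {x. k x \<le> k u}"
      unfolding k_le by simp
    then have "saturation free_real_relations u \<le> Sup {x. k x \<le> k u}"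
      by (simp only: saturation_le_iff[OF sat])
    then show "k (saturation free_real_relations u) \<le> k u"
      unfolding k_le .
    show "k u \<le> k (saturation free_real_relations u)"
      by (rule frame_hom_mono[OF k saturation_upper])
  qed
  define h where "h = (\<lambda>x. k (Rep_frame_of_reals x))"
  have "frame_hom h"
    unfolding frame_hom_def h_def top_frame_of_reals.rep_eq inf_frame_of_reals.rep_eq
      Sup_frame_of_reals.rep_eq k_saturation frame_homD[OF k]
    by (simp add: image_image)
  moreover have "h (real_gen p q) = f p q" for p q
    by (simp add: h_def real_gen_def real_quot.rep_eq k_saturation k_gen)
  ultimately show "\<exists>h. frame_hom h \<and> (\<forall>p q. h (real_gen p q) = f p q)"
    by blast
next
  fix g h :: "frame_of_reals \<Rightarrow> 'a"
  assume g: "frame_hom g \<and> (\<forall>p q. g (real_gen p q) = f p q)"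
    and h: "frame_hom h \<and> (\<forall>p q. h (real_gen p q) = f p q)"
  have eq: "g (real_quot u) = h (real_quot u)" for u
  proof (rule frame_hom_free_eqI[of "\<lambda>u. g (real_quot u)" "\<lambda>u. h (real_quot u)"])
    show "frame_hom (\<lambda>u. g (real_quot u))" "frame_hom (\<lambda>u. h (real_quot u))"
      using g h by (simp_all add: frame_hom_comp frame_hom_real_quot)
    show "g (real_quot (free_gen x)) = h (real_quot (free_gen x))" for x
      using g h by (cases x) (simp add: real_gen_def)
  qed
  show "g = h"
  proof
    fix x
    have "real_quot (Rep_frame_of_reals x) = x"
      using Rep_frame_of_reals[of x]
      by (simp add: saturation_id Rep_frame_of_reals_inverse real_quot_def)
    with eq[of "Rep_frame_of_reals x"] show "g x = h x"
      by simp
  qed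
qed

section \<open>Continuous real functions on a frame\<close>

definition RL :: "(frame_of_reals \<Rightarrow> 'a::frame) set" where
  "RL = {\<alpha>. frame_hom \<alpha>}"

text \<open>The frame homomorphism with prescribed values on the generators; meaningful whenever these
  values satisfy (R1)--(R4).\<close>

definition real_hom :: "(rat \<Rightarrow> rat \<Rightarrow> 'a::frame) \<Rightarrow> frame_of_reals \<Rightarrow> 'a" where
  "real_hom f = (THE h. frame_hom h \<and> (\<forall>p q. h (real_gen p q) = f p q))"

definition rat_ivl :: "rat \<Rightarrow> rat \<Rightarrow> real set" where
  "rat_ivl p q = {t. of_rat p < t \<and> t < of_rat q}"

definition RL_op ::
  "(real \<Rightarrow> real \<Rightarrow> real) \<Rightarrow> (frame_of_reals \<Rightarrow> 'a) \<Rightarrow> (frame_of_reals \<Rightarrow> 'a) \<Rightarrow> (frame_of_reals \<Rightarrow> 'a::frame)"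
  where
  "RL_op d \<alpha> \<beta> = real_hom (\<lambda>p q. Sup {inf (\<alpha> (real_gen r s)) (\<beta> (real_gen u v)) | r s u v.
     {d x y | x y. x \<in> rat_ivl r s \<and> y \<in> rat_ivl u v} \<subseteq> rat_ivl p q})"

text \<open>The additive inverse in the ring of homomorphisms: \<open>-t\<close> lies in \<open>\<langle>p, q\<rangle>\<close> iff \<open>t\<close> lies in
  \<open>\<langle>-q, -p\<rangle>\<close>.\<close>

definition RL_uminus :: "(frame_of_reals \<Rightarrow> 'a) \<Rightarrow> (frame_of_reals \<Rightarrow> 'a::frame)" where
  "RL_uminus \<alpha> = real_hom (\<lambda>p q. \<alpha> (real_gen (- q) (- p)))"

definition RL_minus ::
  "(frame_of_reals \<Rightarrow> 'a) \<Rightarrow> (frame_of_reals \<Rightarrow> 'a) \<Rightarrow> (frame_of_reals \<Rightarrow> 'a::frame)" where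
  "RL_minus \<alpha> \<beta> = RL_op (+) \<alpha> (RL_uminus \<beta>)"

definition RL_const :: "real \<Rightarrow> frame_of_reals \<Rightarrow> 'a::frame" where
  "RL_const r = real_hom (\<lambda>p q. if of_rat p < r \<and> r < of_rat q then top else bot)"

definition real_above :: "rat \<Rightarrow> frame_of_reals" where
  "real_above p = Sup {real_gen r s | r s. r > p \<and> s > p}"

definition real_below :: "rat \<Rightarrow> frame_of_reals" where
  "real_below q = Sup {real_gen r s | r s. r < q \<and> s < q}"

definition coz :: "(frame_of_reals \<Rightarrow> 'a::frame) \<Rightarrow> 'a" where
  "coz \<alpha> = sup (\<alpha> (real_below 0)) (\<alpha> (real_above 0))"

definition R_set :: "(frame_of_reals \<Rightarrow> 'a::frame) \<Rightarrow> real set" where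
  "R_set \<alpha> = {r. coz (RL_minus \<alpha> (RL_const r)) \<noteq> top}"

definition C_c :: "(frame_of_reals \<Rightarrow> 'a::frame) set" where
  "C_c = {\<alpha> \<in> RL. countable (R_set \<alpha>)}"

definition completely_regular :: "'a::frame itself \<Rightarrow> bool" where
  "completely_regular _ \<longleftrightarrow> (\<forall>a::'a. \<exists>S. S \<subseteq> coz ` RL \<and> a = Sup S)"

definition Coz_c :: "'a::frame gorder" where
  "Coz_c = \<lparr>carrier = coz ` C_c, eq = (=), le = (\<le>)\<rparr>"

section \<open>\<open>\<sigma>\<close>-frames and Alexandroff algebras\<close>

definition countable_joins :: "'a gorder \<Rightarrow> bool" where
  "countable_joins M \<longleftrightarrow>
     (\<forall>S. S \<subseteq> carrier M \<and> countable S \<longrightarrow> (\<exists>s. least M s (Upper M S)))"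

definition sigma_frame :: "'a gorder \<Rightarrow> bool" where
  "sigma_frame M \<longleftrightarrow> lattice M \<and>
     (\<forall>a\<in>carrier M. \<forall>b\<in>carrier M. \<forall>c\<in>carrier M.
        a \<sqinter>\<^bsub>M\<^esub> (b \<squnion>\<^bsub>M\<^esub> c) = (a \<sqinter>\<^bsub>M\<^esub> b) \<squnion>\<^bsub>M\<^esub> (a \<sqinter>\<^bsub>M\<^esub> c)) \<and>
     countable_joins M \<and>
     (\<forall>a\<in>carrier M. \<forall>S. S \<subseteq> carrier M \<and> countable S \<longrightarrow>
        a \<sqinter>\<^bsub>M\<^esub> (\<Squnion>\<^bsub>M\<^esub>S) = \<Squnion>\<^bsub>M\<^esub>((\<lambda>s. a \<sqinter>\<^bsub>M\<^esub> s) ` S))"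

definition sigma_lattice :: "'a gorder \<Rightarrow> bool" where
  "sigma_lattice M \<longleftrightarrow> bounded_lattice M \<and> countable_joins M"

definition normal_lattice :: "'a gorder \<Rightarrow> bool" where
  "normal_lattice M \<longleftrightarrow> bounded_lattice M \<and>
     (\<forall>a\<in>carrier M. \<forall>b\<in>carrier M. a \<squnion>\<^bsub>M\<^esub> b = \<top>\<^bsub>M\<^esub> \<longrightarrow>
        (\<exists>u\<in>carrier M. \<exists>v\<in>carrier M.
           a \<squnion>\<^bsub>M\<^esub> u = \<top>\<^bsub>M\<^esub> \<and> v \<squnion>\<^bsub>M\<^esub> b = \<top>\<^bsub>M\<^esub> \<and> u \<sqinter>\<^bsub>M\<^esub> v = \<bottom>\<^bsub>M\<^esub>))"

definition alexandroff_algebra :: "'a gorder \<Rightarrow> bool" where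
  "alexandroff_algebra M \<longleftrightarrow> sigma_lattice M \<and> normal_lattice M \<and>
     (\<forall>a\<in>carrier M. \<exists>(x :: nat \<Rightarrow> 'a) (y :: nat \<Rightarrow> 'a).
        (\<forall>n. x n \<in> carrier M \<and> y n \<in> carrier M \<and>
             y n \<squnion>\<^bsub>M\<^esub> a = \<top>\<^bsub>M\<^esub> \<and> y n \<sqinter>\<^bsub>M\<^esub> x n = \<bottom>\<^bsub>M\<^esub>) \<and>
        \<Squnion>\<^bsub>M\<^esub>(range x) = a)"

end

theory Submission
  imports Defs "HOL-Analysis.Continuum_Not_Denumerable"
begin

text \<open>An element of \<open>L\<close> is of the form \<open>coz(\<alpha>)\<close> with \<open>\<alpha> \<in> \<C>\<^sub>c(L)\<close> iff it is a countable join of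
  complemented elements. For \<open>r \<notin> R\<^sub>\<alpha>\<close> the elements \<open>\<alpha>(r,-)\<close> and \<open>\<alpha>(-,r)\<close> are complements of each
  other, and if \<open>R\<^sub>\<alpha>\<close> is countable then such \<open>r\<close> exist arbitrarily close to \<open>0\<close> on both sides, so
  \<open>coz(\<alpha>)\<close> is a countable join of these. Conversely, a countable join of complemented elements is
  the cozero element of a homomorphism with values \<open>0\<close> and \<open>1/n\<close>. In the countable joins of
  complemented elements, both normality and the Alexandroff sequences are read off increasing
  sequences of complemented elements.\<close>

section \<open>Distributivity in frames\<close>

lemma frame_inf_sup: "inf (a::'a::frame) (sup b c) = sup (inf a b) (inf a c)"
  using inf_Sup[of a "{b, c}"] by simp

lemma frame_sup_inf: "sup (a::'a::frame) (inf b c) = inf (sup a b) (sup a c)"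
  by (rule distrib_imp1) (rule frame_inf_sup)

text \<open>The frame law is applied once in each argument. This reduces bounds on a meet of two
  joins to bounds on meets of members.\<close>

lemma inf_Sup_Sup_le:
  fixes c :: "'a::frame"
  assumes "\<And>x y. x \<in> A \<Longrightarrow> y \<in> B \<Longrightarrow> inf x y \<le> c"
  shows "inf (Sup A) (Sup B) \<le> c"
proof -
  have *: "inf (Sup B) x \<le> c" if "x \<in> A" for x
    unfolding inf.commute[of "Sup B"] inf_Sup[of x B] using assms that by (auto intro: SUP_least)
  have "inf (Sup B) (Sup A) \<le> c"
    unfolding inf_Sup[of "Sup B" A] using * by (auto intro: SUP_least)
  then show ?thesis
    by (simp only: inf.commute)
qed

lemma Sup_UN: "Sup (\<Union>x\<in>A. B x) = (SUP x\<in>A. Sup (B x :: 'a::complete_lattice set))"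
  using SUP_UNION[of "\<lambda>x. x" B A] by simp

section \<open>Complemented elements of a frame\<close>

definition complements :: "'a::bounded_lattice \<Rightarrow> 'a \<Rightarrow> bool" where
  "complements x y \<longleftrightarrow> inf x y = bot \<and> sup x y = top"

lemma complements_sym: "complements x y \<Longrightarrow> complements y x"
  by (simp add: complements_def inf.commute sup.commute)

lemma complements_disjoint: "complements x y \<Longrightarrow> a \<le> x \<Longrightarrow> b \<le> y \<Longrightarrow> inf a b = bot"
  unfolding complements_def by (metis bot.extremum_uniqueI inf_mono)

lemma complements_cover: "complements x y \<Longrightarrow> x \<le> a \<Longrightarrow> y \<le> b \<Longrightarrow> sup a b = top"
  unfolding complements_def by (metis sup_mono top_le)

lemma complements_sup:
  fixes x :: "'a::frame"
  assumes "complements x y" "complements x' y'"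
  shows "complements (sup x x') (inf y y')"
  unfolding complements_def
proof
  have bot: "inf y x = bot" "inf y' x' = bot" and top: "sup x y = top" "sup x' y' = top"
    using assms by (simp_all add: complements_def inf.commute)
  have "inf (inf y y') x = bot"
    by (metis bot(1) inf.assoc inf.commute inf_bot_right)
  moreover have "inf (inf y y') x' = bot"
    by (simp add: bot(2) inf.assoc)
  ultimately show "inf (sup x x') (inf y y') = bot"
    by (simp add: inf.commute[of "sup x x'"] frame_inf_sup)
  have "sup (sup x x') y = top"
    by (metis top(1) sup.assoc sup.commute sup_top_right)
  moreover have "sup (sup x x') y' = top"
    by (simp add: top(2) sup.assoc)
  ultimately show "sup (sup x x') (inf y y') = top"
    by (simp add: frame_sup_inf)
qed

lemma complements_inf:
  fixes x :: "'a::frame"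
  shows "complements x y \<Longrightarrow> complements x' y' \<Longrightarrow> complements (inf x x') (sup y y')"
  by (intro complements_sym[OF complements_sup] complements_sym[of x] complements_sym[of x'])

text \<open>By distributivity and \<open>sup x y = top\<close> the right-hand side is just
  \<open>sup x a\<close>. It is used to split \<open>a\<close> along \<open>x\<close> and its
  complement.\<close>

lemma complements_le:
  fixes x :: "'a::frame"
  assumes "complements x y"
  shows "a \<le> sup x (inf y a)"
  using assms by (simp add: complements_def frame_sup_inf)

section \<open>Frame homomorphisms from cuts\<close>

text \<open>\<open>U p\<close> and \<open>V q\<close> play the roles of \<open>\<alpha>(p,-)\<close> and \<open>\<alpha>(-,q)\<close>.\<close>

locale real_cuts =
  fixes U V :: "rat \<Rightarrow> 'a::frame"
  assumes U_anti: "p \<le> q \<Longrightarrow> U q \<le> U p"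
    and V_mono: "p \<le> q \<Longrightarrow> V p \<le> V q"
    and disjoint: "q \<le> p \<Longrightarrow> inf (U p) (V q) = bot"
    and cover: "p < q \<Longrightarrow> sup (U p) (V q) = top"
    and U_cont: "U p \<le> Sup {U r | r. p < r}"
    and V_cont: "V q \<le> Sup {V s | s. s < q}"
    and Sup_U: "Sup (range U) = top"
    and Sup_V: "Sup (range V) = top"
begin

text \<open>An interval is the meet of two half-lines. (R1) then comes from monotonicity, (R2) from
  \<open>cover\<close>, (R3) from the two continuity conditions together with
  \<open>disjoint\<close>, and (R4) from the two joins being \<open>top\<close>.\<close>

lemma real_relations_cuts: "\<forall>(u, v)\<in>real_relations (\<lambda>p q. inf (U p) (V q)). u = v"
proof -
  have U_max: "inf (U p) (U r) = U (max p r)" for p r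
    by (cases "p \<le> r") (simp_all add: U_anti inf.absorb1 inf.absorb2 max_def)
  have V_min: "inf (V q) (V s) = V (min q s)" for q s
    by (cases "q \<le> s") (simp_all add: V_mono inf.absorb1 inf.absorb2 min_def)
  have R1: "inf (inf (U p) (V q)) (inf (U r) (V s)) = inf (U (max p r)) (V (min q s))" for p q r s
    unfolding U_max[symmetric] V_min[symmetric] by (simp add: inf.assoc inf.left_commute)
  have R2: "sup (inf (U p) (V q)) (inf (U r) (V s)) = inf (U p) (V s)"
    if "p \<le> r" "r < q" "q \<le> s" for p q r s
  proof (rule antisym)
    show "sup (inf (U p) (V q)) (inf (U r) (V s)) \<le> inf (U p) (V s)"
      using that by (auto intro: le_infI1 le_infI2 U_anti V_mono)
    \<comment> \<open>The overlap \<open>r < q\<close> makes \<open>sup (U r) (V q)\<close> equal to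
      \<open>top\<close>. Distributing over it yields one piece below each of the two
      intervals.\<close>
    have "inf (U p) (V s) = inf (inf (U p) (V s)) (sup (U r) (V q))"
      using cover[OF that(2)] by simp
    also have "\<dots> \<le> sup (inf (U p) (V q)) (inf (U r) (V s))"
      unfolding frame_inf_sup
      by (intro sup_least, rule le_supI2, simp add: le_infI1, rule le_supI1, simp add: le_infI1)
    finally show "inf (U p) (V s) \<le> sup (inf (U p) (V q)) (inf (U r) (V s))" .
  qed
  have R3: "inf (U p) (V q) = Sup {inf (U r) (V s) | r s. p < r \<and> r < s \<and> s < q}" (is "_ = ?S") for p q
  proof (rule antisym)
    have "inf (U p) (V q) \<le> inf (Sup {U r | r. p < r}) (Sup {V s | s. s < q})"
      by (rule inf_mono[OF U_cont V_cont])
    also have "\<dots> \<le> ?S"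
    proof (rule inf_Sup_Sup_le, clarsimp)
      fix r s
      assume "p < r" "s < q"
      \<comment> \<open>When \<open>s \<le> r\<close> the meet is \<open>bot\<close>, so only the
        pairs indexed in \<open>?S\<close> matter.\<close>
      then show "inf (U r) (V s) \<le> ?S"
        by (cases "r < s") (auto intro!: Sup_upper simp: disjoint)
    qed
    finally show "inf (U p) (V q) \<le> ?S" .
    show "?S \<le> inf (U p) (V q)"
    proof (rule Sup_least, clarify)
      fix r s
      assume "p < r" "r < s" "s < q"
      then show "inf (U r) (V s) \<le> inf (U p) (V q)"
        by (intro inf_mono U_anti V_mono) simp_all
    qed
  qed
  have R4: "top = Sup {inf (U p) (V q) | p q. True}" (is "_ = ?S")
  proof (rule antisym)
    have "inf (Sup (range U)) (Sup (range V)) \<le> ?S"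
      by (rule inf_Sup_Sup_le) (auto intro: Sup_upper)
    then show "top \<le> ?S"
      by (simp add: Sup_U Sup_V)
  qed simp
  show ?thesis
    unfolding real_relations_def using R1 R2 R3[symmetric] R4 by auto
qed

end

section \<open>The defining relations for the generators of the frame of reals\<close>

lemma real_hom:
  assumes "\<forall>(u, v)\<in>real_relations f. u = v"
  shows "real_hom f \<in> RL" "real_hom f (real_gen p q) = f p q"
  using theI'[OF real_universal[OF assms]] unfolding real_hom_def RL_def by auto

lemma real_gen_eqI: "(u, v) \<in> real_relations real_gen \<Longrightarrow> u = v"
  using real_gen_relations by fast

lemma real_gen_inf: "inf (real_gen p q) (real_gen r s) = real_gen (max p r) (min q s)"
  by (rule real_gen_eqI) (auto simp: real_relations_def)

lemma real_gen_sup: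
  "p \<le> r \<Longrightarrow> r < q \<Longrightarrow> q \<le> s \<Longrightarrow> sup (real_gen p q) (real_gen r s) = real_gen p s"
  by (rule real_gen_eqI) (auto simp: real_relations_def)

lemma real_gen_Sup: "real_gen p q = Sup {real_gen r s | r s. p < r \<and> r < s \<and> s < q}"
  by (rule real_gen_eqI) (auto simp: real_relations_def)

lemma Sup_real_gen: "Sup {real_gen p q | p q. True} = top"
  by (rule real_gen_eqI[symmetric]) (auto simp: real_relations_def)

lemma real_gen_mono: "p' \<le> p \<Longrightarrow> q \<le> q' \<Longrightarrow> real_gen p q \<le> real_gen p' q'"
  using real_gen_inf[of p q p' q'] by (metis inf.absorb_iff1 max.absorb1 min.absorb1)

text \<open>For \<open>q \<le> p\<close> the join in (R3) is over the empty set.\<close>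

lemma real_gen_empty:
  assumes "q \<le> p"
  shows "real_gen p q = bot"
proof -
  have "{real_gen r s | r s. p < r \<and> r < s \<and> s < q} = {}"
    using assms by auto
  then show ?thesis
    using real_gen_Sup[of p q] by (simp only: Sup_empty)
qed

section \<open>Values on real half-lines\<close>

text \<open>These are the values \<alpha>(x,-) and \<alpha>(-,x) at a real, possibly irrational, x,
  as the points of \<open>R_set\<close> require. Only the endpoint nearer to x is constrained: for a
  homomorphism the degenerate intervals contribute \<open>bot\<close>.\<close>

definition upper_part :: "(frame_of_reals \<Rightarrow> 'a) \<Rightarrow> real \<Rightarrow> 'a::frame" where
  "upper_part \<alpha> x = Sup {\<alpha> (real_gen a b) | a b. x < of_rat a}"

definition lower_part :: "(frame_of_reals \<Rightarrow> 'a) \<Rightarrow> real \<Rightarrow> 'a::frame" where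
  "lower_part \<alpha> x = Sup {\<alpha> (real_gen a b) | a b. of_rat b < x}"

lemma upper_part_upper: "x < of_rat a \<Longrightarrow> \<alpha> (real_gen a b) \<le> upper_part \<alpha> x"
  unfolding upper_part_def by (rule Sup_upper) auto

lemma lower_part_upper: "of_rat b < x \<Longrightarrow> \<alpha> (real_gen a b) \<le> lower_part \<alpha> x"
  unfolding lower_part_def by (rule Sup_upper) auto

lemma upper_part_anti: "x \<le> y \<Longrightarrow> upper_part \<alpha> y \<le> upper_part \<alpha> x"
  unfolding upper_part_def[of \<alpha> y] by (rule Sup_least) (auto intro: upper_part_upper)

lemma lower_part_mono: "x \<le> y \<Longrightarrow> lower_part \<alpha> x \<le> lower_part \<alpha> y"
  unfolding lower_part_def[of \<alpha> x] by (rule Sup_least) (auto intro: lower_part_upper)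

lemma RL_bot: "\<alpha> \<in> RL \<Longrightarrow> \<alpha> bot = bot"
  using frame_homD(3)[of \<alpha> "{}"] by (simp add: RL_def)

lemma RL_gen_inf:
  "\<alpha> \<in> RL \<Longrightarrow> inf (\<alpha> (real_gen p q)) (\<alpha> (real_gen r s)) = \<alpha> (real_gen (max p r) (min q s))"
  by (simp add: RL_def frame_homD(2)[symmetric] real_gen_inf)

text \<open>By (R1) each meet of generator values is the value at an interval whose left endpoint is
  not below its right one, hence \<open>bot\<close>.\<close>

lemma upper_inf_lower:
  assumes "\<alpha> \<in> RL" "y \<le> x"
  shows "inf (upper_part \<alpha> x) (lower_part \<alpha> y) = bot"
proof -
  have "inf (upper_part \<alpha> x) (lower_part \<alpha> y) \<le> bot"
    unfolding upper_part_def lower_part_def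
  proof (rule inf_Sup_Sup_le, clarify)
    fix a b c d :: rat
    assume "x < of_rat a" "of_rat d < y"
    then have "of_rat d < (of_rat a :: real)"
      using assms(2) by linarith
    then have "min b d \<le> max a c"
      by (simp add: of_rat_less min_le_iff_disj le_max_iff_disj)
    then show "inf (\<alpha> (real_gen a b)) (\<alpha> (real_gen c d)) \<le> bot"
      by (simp add: RL_gen_inf[OF assms(1)] real_gen_empty RL_bot[OF assms(1)])
  qed
  then show ?thesis
    by (rule bot.extremum_uniqueI)
qed

lemma RL_Sup_gen:
  assumes "\<alpha> \<in> RL"
  shows "Sup {\<alpha> (real_gen a b) | a b. True} = top"
proof -
  have hom: "frame_hom \<alpha>"
    using assms by (simp add: RL_def)
  have "top = \<alpha> (Sup {real_gen p q | p q. True})"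
    unfolding Sup_real_gen frame_homD(1)[OF hom] ..
  also have "\<dots> = Sup (\<alpha> ` {real_gen p q | p q. True})"
    by (rule frame_homD(3)[OF hom])
  also have "\<alpha> ` {real_gen p q | p q. True} = {\<alpha> (real_gen a b) | a b. True}"
    by auto
  finally show ?thesis ..
qed

text \<open>Choose rationals m < n between x and y and widen any interval until it contains both. By
  (R2) it is the join of a piece ending at n < y and a piece starting at m > x. By (R4) the
  intervals exhaust \<open>top\<close>.\<close>

lemma upper_sup_lower:
  assumes "\<alpha> \<in> RL" "x < y"
  shows "sup (upper_part \<alpha> x) (lower_part \<alpha> y) = top"
proof (rule top_le)
  obtain m where m: "x < of_rat m" "of_rat m < y"
    using of_rat_dense[OF assms(2)] by blast
  obtain n where n: "of_rat m < (of_rat n :: real)" "of_rat n < y"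
    using of_rat_dense[OF m(2)] by blast
  have "\<alpha> (real_gen a b) \<le> sup (upper_part \<alpha> x) (lower_part \<alpha> y)" for a b
  proof -
    have "\<alpha> (real_gen a b) \<le> \<alpha> (real_gen (min a m) (max b n))"
      by (rule frame_hom_mono[of \<alpha>]) (use assms(1) in \<open>simp_all add: RL_def real_gen_mono\<close>)
    also have "real_gen (min a m) (max b n) = sup (real_gen (min a m) n) (real_gen m (max b n))"
      using n(1) by (intro real_gen_sup[symmetric]) (simp_all add: of_rat_less)
    also have "\<alpha> \<dots> = sup (\<alpha> (real_gen (min a m) n)) (\<alpha> (real_gen m (max b n)))"
      using assms(1) unfolding RL_def by (simp add: frame_hom_sup)
    also have "\<dots> \<le> sup (upper_part \<alpha> x) (lower_part \<alpha> y)"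
      using m n by (auto intro: le_supI1 le_supI2 upper_part_upper lower_part_upper)
    finally show ?thesis .
  qed
  then have "Sup {\<alpha> (real_gen a b) | a b. True} \<le> sup (upper_part \<alpha> x) (lower_part \<alpha> y)"
    by (auto intro: Sup_least)
  then show "top \<le> sup (upper_part \<alpha> x) (lower_part \<alpha> y)"
    by (simp only: RL_Sup_gen[OF assms(1)])
qed

text \<open>These are the half-line values that \<alpha> - c should have. Density of the rationals
  in the reals supplies the continuity conditions even for irrational c.\<close>

lemma real_cuts_translate:
  assumes "\<alpha> \<in> RL"
  shows "real_cuts (\<lambda>p. upper_part \<alpha> (of_rat p + c)) (\<lambda>q. lower_part \<alpha> (of_rat q + c))"
proof
  fix p q :: rat
  show "p \<le> q \<Longrightarrow> upper_part \<alpha> (of_rat q + c) \<le> upper_part \<alpha> (of_rat p + c)"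
    "p \<le> q \<Longrightarrow> lower_part \<alpha> (of_rat p + c) \<le> lower_part \<alpha> (of_rat q + c)"
    by (auto intro!: upper_part_anti lower_part_mono simp: of_rat_less_eq)
  show "q \<le> p \<Longrightarrow> inf (upper_part \<alpha> (of_rat p + c)) (lower_part \<alpha> (of_rat q + c)) = bot"
    by (rule upper_inf_lower[OF assms]) (simp add: of_rat_less_eq)
  show "p < q \<Longrightarrow> sup (upper_part \<alpha> (of_rat p + c)) (lower_part \<alpha> (of_rat q + c)) = top"
    by (rule upper_sup_lower[OF assms]) (simp add: of_rat_less)
  show "upper_part \<alpha> (of_rat p + c) \<le> Sup {upper_part \<alpha> (of_rat r + c) | r. p < r}" (is "_ \<le> ?S")
    unfolding upper_part_def[of \<alpha> "of_rat p + c"]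
  proof (rule Sup_least, clarify)
    fix a b
    assume "of_rat p + c < of_rat a"
    then obtain r where r: "of_rat p < (of_rat r :: real)" "of_rat r < of_rat a - c"
      using of_rat_dense[of "of_rat p" "of_rat a - c"] by auto
    then have "\<alpha> (real_gen a b) \<le> upper_part \<alpha> (of_rat r + c)"
      by (intro upper_part_upper) simp
    also have "\<dots> \<le> ?S"
      using r by (intro Sup_upper) (auto simp: of_rat_less)
    finally show "\<alpha> (real_gen a b) \<le> ?S" .
  qed
  show "lower_part \<alpha> (of_rat q + c) \<le> Sup {lower_part \<alpha> (of_rat s + c) | s. s < q}" (is "_ \<le> ?S")
    unfolding lower_part_def[of \<alpha> "of_rat q + c"]
  proof (rule Sup_least, clarify)
    fix a b
    assume "of_rat b < of_rat q + c"
    then obtain s where s: "of_rat b - c < of_rat s" "of_rat s < (of_rat q :: real)"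
      using of_rat_dense[of "of_rat b - c" "of_rat q"] by auto
    then have "\<alpha> (real_gen a b) \<le> lower_part \<alpha> (of_rat s + c)"
      by (intro lower_part_upper) simp
    also have "\<dots> \<le> ?S"
      using s by (intro Sup_upper) (auto simp: of_rat_less)
    finally show "\<alpha> (real_gen a b) \<le> ?S" .
  qed
  have "\<exists>p. \<alpha> (real_gen a b) \<le> upper_part \<alpha> (of_rat p + c)" for a b
  proof -
    obtain p where "of_rat p < of_rat a - c"
      using of_rat_dense[of "of_rat a - c - 1" "of_rat a - c"] by auto
    then show ?thesis
      by (intro exI[of _ p] upper_part_upper) simp
  qed
  then have "Sup {\<alpha> (real_gen a b) | a b. True} \<le> (SUP p. upper_part \<alpha> (of_rat p + c))"
    by (intro Sup_least) (blast intro: SUP_upper2)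
  then show "(SUP p. upper_part \<alpha> (of_rat p + c)) = top"
    by (intro top_le) (simp only: RL_Sup_gen[OF assms])
  have "\<exists>q. \<alpha> (real_gen a b) \<le> lower_part \<alpha> (of_rat q + c)" for a b
  proof -
    obtain q where "of_rat b - c < of_rat q"
      using of_rat_dense[of "of_rat b - c" "of_rat b - c + 1"] by auto
    then show ?thesis
      by (intro exI[of _ q] lower_part_upper) simp
  qed
  then have "Sup {\<alpha> (real_gen a b) | a b. True} \<le> (SUP q. lower_part \<alpha> (of_rat q + c))"
    by (intro Sup_least) (blast intro: SUP_upper2)
  then show "(SUP q. lower_part \<alpha> (of_rat q + c)) = top"
    by (intro top_le) (simp only: RL_Sup_gen[OF assms])
qed

text \<open>\<open>real_above\<close> and \<open>real_below\<close> constrain both endpoints,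
  whereas the parts constrain one. The extra intervals are degenerate and are sent to
  \<open>bot\<close>.\<close>

lemma coz_parts:
  assumes "\<alpha> \<in> RL"
  shows "coz \<alpha> = sup (lower_part \<alpha> 0) (upper_part \<alpha> 0)"
proof -
  have hom: "frame_hom \<alpha>"
    using assms by (simp add: RL_def)
  have *: "\<alpha> (Sup {real_gen r s | r s. P r s}) = Sup {\<alpha> (real_gen r s) | r s. P r s}" for P
    unfolding frame_homD(3)[OF hom] by (rule arg_cong[where f = Sup]) auto
  have "\<alpha> (real_below 0) = lower_part \<alpha> 0"
    unfolding real_below_def lower_part_def *
  proof (rule antisym; rule Sup_least; clarify)
    fix r s :: rat
    assume "of_rat s < (0::real)"
    then have "r < 0 \<and> s < 0 \<or> real_gen r s = bot"
      by (cases "r < 0") (auto simp: real_gen_empty)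
    then show "\<alpha> (real_gen r s) \<le> Sup {\<alpha> (real_gen r s) | r s. r < 0 \<and> s < 0}"
      by (auto intro: Sup_upper simp: RL_bot[OF assms])
  qed (auto intro: Sup_upper)
  moreover have "\<alpha> (real_above 0) = upper_part \<alpha> 0"
    unfolding real_above_def upper_part_def *
  proof (rule antisym; rule Sup_least; clarify)
    fix r s :: rat
    assume "(0::real) < of_rat r"
    then have "r > 0 \<and> s > 0 \<or> real_gen r s = bot"
      by (cases "s > 0") (auto simp: real_gen_empty)
    then show "\<alpha> (real_gen r s) \<le> Sup {\<alpha> (real_gen r s) | r s. r > 0 \<and> s > 0}"
      by (auto intro: Sup_upper simp: RL_bot[OF assms])
  qed (auto intro: Sup_upper)
  ultimately show ?thesis
    by (simp add: coz_def)
qed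

section \<open>Half-line values of a homomorphism given by cuts\<close>

context real_cuts
begin

abbreviation "cut_hom \<equiv> real_hom (\<lambda>p q. inf (U p) (V q))"

lemmas cut_hom = real_hom[OF real_relations_cuts]

text \<open>Since the \<open>V q\<close> join to \<open>top\<close>, the element \<open>U p\<close>
  is the join of the values at the intervals (p,q) over all q.\<close>

lemma U_le_upper_part:
  assumes "x < of_rat p"
  shows "U p \<le> upper_part cut_hom x"
proof -
  have "inf (U p) (V q) \<le> upper_part cut_hom x" for q
    using upper_part_upper[of x p cut_hom q] assms by (simp add: cut_hom(2))
  then have "inf (U p) (Sup (range V)) \<le> upper_part cut_hom x"
    unfolding inf_Sup by (auto intro: SUP_least)
  then show ?thesis
    by (simp add: Sup_V)
qed

lemma V_le_lower_part:
  assumes "of_rat q < x"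
  shows "V q \<le> lower_part cut_hom x"
proof -
  have "inf (V q) (U p) \<le> lower_part cut_hom x" for p
    using lower_part_upper[of q x cut_hom p] assms by (simp add: cut_hom(2) inf.commute)
  then have "inf (V q) (Sup (range U)) \<le> lower_part cut_hom x"
    unfolding inf_Sup by (auto intro: SUP_least)
  then show ?thesis
    by (simp add: Sup_U)
qed

text \<open>The upper part at p sees only endpoints strictly above p. Continuity of \<open>U\<close>
  recovers \<open>U p\<close> from those.\<close>

lemma upper_part_cut_hom: "upper_part cut_hom (of_rat p) = U p"
proof (rule antisym)
  show "upper_part cut_hom (of_rat p) \<le> U p"
    unfolding upper_part_def
    by (rule Sup_least) (auto simp: cut_hom(2) of_rat_less intro!: le_infI1 U_anti)
  have "Sup {U r | r. p < r} \<le> upper_part cut_hom (of_rat p)"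
    by (rule Sup_least) (auto simp: of_rat_less intro: U_le_upper_part)
  then show "U p \<le> upper_part cut_hom (of_rat p)"
    by (rule order_trans[OF U_cont])
qed

lemma lower_part_cut_hom: "lower_part cut_hom (of_rat q) = V q"
proof (rule antisym)
  show "lower_part cut_hom (of_rat q) \<le> V q"
    unfolding lower_part_def
    by (rule Sup_least) (auto simp: cut_hom(2) of_rat_less intro!: le_infI2 V_mono)
  have "Sup {V s | s. s < q} \<le> lower_part cut_hom (of_rat q)"
    by (rule Sup_least) (auto simp: of_rat_less intro: V_le_lower_part)
  then show "V q \<le> lower_part cut_hom (of_rat q)"
    by (rule order_trans[OF V_cont])
qed

lemma coz_cut_hom: "coz cut_hom = sup (V 0) (U 0)"
  using coz_parts[OF cut_hom(1)] upper_part_cut_hom[of 0] lower_part_cut_hom[of 0] by simp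

end

section \<open>Constants and the difference of a homomorphism and a constant\<close>

lemma real_cuts_const:
  fixes r :: real
  defines "T \<equiv> \<lambda>b. if b then top else bot :: 'a::frame"
  shows "real_cuts (\<lambda>p. T (of_rat p < r)) (\<lambda>q. T (r < of_rat q))"
proof
  have T: "T True = top" "T False = bot"
    by (simp_all add: T_def)
  have mono: "T b \<le> T b'" if "b \<longrightarrow> b'" for b b'
    using that by (simp add: T_def)
  fix p q :: rat
  show "T (of_rat p < r) \<le> Sup {T (of_rat p' < r) | p'. p < p'}" (is "_ \<le> ?S")
  proof (cases "of_rat p < r")
    case True
    obtain p' where p': "p < p'" "of_rat p' < r"
      using of_rat_dense[OF True] by (auto simp: of_rat_less)
    have "T (of_rat p' < r) \<le> ?S"
      using p'(1) by (blast intro: Sup_upper)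
    with True p'(2) show ?thesis
      by simp
  qed (simp add: T)
  show "T (r < of_rat q) \<le> Sup {T (r < of_rat q') | q'. q' < q}" (is "_ \<le> ?S")
  proof (cases "r < of_rat q")
    case True
    obtain q' where q': "q' < q" "r < of_rat q'"
      using of_rat_dense[OF True] by (auto simp: of_rat_less)
    have "T (r < of_rat q') \<le> ?S"
      using q'(1) by (blast intro: Sup_upper)
    with True q'(2) show ?thesis
      by simp
  qed (simp add: T)
  obtain p0 where "of_rat p0 < r"
    using of_rat_dense[of "r - 1" r] by auto
  then show "(SUP p. T (of_rat p < r)) = top"
    by (intro top_le SUP_upper2[of p0]) (simp_all add: T)
  obtain q0 where "r < of_rat q0"
    using of_rat_dense[of r "r + 1"] by auto
  then show "(SUP q. T (r < of_rat q)) = top"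
    by (intro top_le SUP_upper2[of q0]) (simp_all add: T)
  have less: "p < q \<Longrightarrow> of_rat p < r \<or> r < of_rat q"
    using of_rat_less[of p q, where 'a = real] by linarith
  show "sup (T (of_rat p < r)) (T (r < of_rat q)) = top" if "p < q"
    using less[OF that] by (auto simp: T)
  have le: "p \<le> q \<Longrightarrow> of_rat p \<le> (of_rat q :: real)" for p q
    by (simp add: of_rat_less_eq)
  show "inf (T (of_rat p < r)) (T (r < of_rat q)) = bot" if "q \<le> p"
    using le[OF that] by (cases "of_rat p < r") (simp_all add: T)
  show "T (of_rat q < r) \<le> T (of_rat p < r)" "T (r < of_rat p) \<le> T (r < of_rat q)" if "p \<le> q"
    using le[OF that] by (auto intro!: mono)
qed

text \<open>The condition on (p,q) splits into a meet of a condition on p and one on q, so the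
  constant is a homomorphism given by cuts.\<close>

lemma RL_const_gen:
  "RL_const r (real_gen p q) = (if of_rat p < r \<and> r < of_rat q then top else bot :: 'a::frame)"
proof -
  have *: "(\<lambda>p q. if of_rat p < r \<and> r < of_rat q then top else bot :: 'a)
      = (\<lambda>p q. inf (if of_rat p < r then top else bot) (if r < of_rat q then top else bot))"
    by (intro ext) auto
  show ?thesis
    unfolding RL_const_def * by (subst real_cuts.cut_hom(2)[OF real_cuts_const]) auto
qed

lemma RL_uminus_const: "RL_uminus (RL_const r) = RL_const (- r)"
  unfolding RL_uminus_def RL_const_gen RL_const_def[of "- r"]
  by (rule arg_cong[where f = real_hom], intro ext) (auto simp: of_rat_minus)

text \<open>If -c lies in \<langle>u,v\<rangle> and r < s, then \<langle>r,s\<rangle> +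
  \<langle>u,v\<rangle> inside \<langle>p,q\<rangle> forces p + c < r and s < q + c. Conversely,
  these two strict inequalities leave room for rationals u < -c < v making the inclusion
  true.\<close>

lemma RL_minus_const:
  assumes "\<alpha> \<in> RL"
  shows "RL_minus \<alpha> (RL_const c)
    = real_hom (\<lambda>p q. inf (upper_part \<alpha> (of_rat p + c)) (lower_part \<alpha> (of_rat q + c)))"
  unfolding RL_minus_def RL_uminus_const RL_op_def
proof (rule arg_cong[where f = real_hom], intro ext antisym)
  fix p q :: rat
  let ?A = "{inf (\<alpha> (real_gen r s)) (RL_const (- c) (real_gen u v)) | r s u v.
    {x + y | x y. x \<in> rat_ivl r s \<and> y \<in> rat_ivl u v} \<subseteq> rat_ivl p q}"
  let ?B = "inf (upper_part \<alpha> (of_rat p + c)) (lower_part \<alpha> (of_rat q + c))"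
  show "Sup ?A \<le> ?B"
  proof (rule Sup_least, clarify)
    fix r s u v :: rat
    assume sub: "{x + y | x y. x \<in> rat_ivl r s \<and> y \<in> rat_ivl u v} \<subseteq> rat_ivl p q"
    \<comment> \<open>If \<langle>r,s\<rangle> is empty or -c is outside \<langle>u,v\<rangle>, one
      of the two factors is \<open>bot\<close>.\<close>
    show "inf (\<alpha> (real_gen r s)) (RL_const (- c) (real_gen u v)) \<le> ?B"
    proof (cases "r < s \<and> of_rat u < - c \<and> - c < of_rat v")
      case False
      then show ?thesis
        by (auto simp: RL_const_gen real_gen_empty RL_bot[OF assms])
    next
      case True
      have sub': "of_rat p < x + y \<and> x + y < of_rat q"
        if "of_rat r < x" "x < of_rat s" "of_rat u < y" "y < of_rat v" for x y :: real
        using sub that unfolding rat_ivl_def by blast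
      have rs: "of_rat r < (of_rat s :: real)"
        using True by (simp add: of_rat_less)
      \<comment> \<open>Letting x tend to r in the inclusion gives only a weak inequality. Taking y
        strictly below -c makes the resulting bound on r strict; z does the same for s.\<close>
      obtain y where y: "of_rat u < y" "y < - c"
        using True dense by blast
      have "of_rat p - y \<le> of_rat r"
      proof (rule dense_ge_bounded[OF rs])
        fix x :: real
        assume "of_rat r < x" "x < of_rat s"
        then show "of_rat p - y \<le> x"
          using sub'[of x y] y True by simp
      qed
      then have 1: "of_rat p + c < of_rat r"
        using y by simp
      obtain z where z: "- c < z" "z < of_rat v"
        using True dense by blast
      have "of_rat s \<le> of_rat q - z"
      proof (rule dense_le_bounded[OF rs])
        fix x :: real
        assume "of_rat r < x" "x < of_rat s"
        then show "x \<le> of_rat q - z"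
          using sub'[of x z] z True by simp
      qed
      then have 2: "of_rat s < of_rat q + c"
        using z by simp
      show ?thesis
        using 1 2 by (intro le_infI1 le_infI upper_part_upper lower_part_upper)
    qed
  qed
  show "?B \<le> Sup ?A"
    unfolding upper_part_def lower_part_def
  proof (rule inf_Sup_Sup_le, clarsimp)
    fix a b a' b' :: rat
    assume a: "of_rat p + c < of_rat a" and b': "of_rat b' < of_rat q + c"
    \<comment> \<open>By (R1) the meet of the two generator values is the value at (r,s), which has
      both endpoints under control.\<close>
    define r where "r = max a a'"
    define s where "s = min b b'"
    have r: "of_rat p + c < of_rat r" and s: "of_rat s < of_rat q + c"
      using a b' of_rat_less_eq[of a r, where 'a = real] of_rat_less_eq[of s b', where 'a = real]
      unfolding r_def s_def by force+
    obtain u where u: "of_rat p - of_rat r < (of_rat u :: real)" "of_rat u < - c"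
      using of_rat_dense[of "of_rat p - of_rat r" "- c"] r by auto
    obtain v where v: "- c < of_rat v" "of_rat v < (of_rat q - of_rat s :: real)"
      using of_rat_dense[of "- c" "of_rat q - of_rat s"] s by auto
    have "{x + y | x y. x \<in> rat_ivl r s \<and> y \<in> rat_ivl u v} \<subseteq> rat_ivl p q"
      using u v by (auto simp: rat_ivl_def)
    then have "inf (\<alpha> (real_gen r s)) (RL_const (- c) (real_gen u v)) \<le> Sup ?A"
      by (intro Sup_upper) blast
    then show "inf (\<alpha> (real_gen a b)) (\<alpha> (real_gen a' b')) \<le> Sup ?A"
      using u v by (simp add: RL_gen_inf[OF assms] RL_const_gen r_def s_def)
  qed
qed

lemma coz_minus_const:
  assumes "\<alpha> \<in> RL"
  shows "coz (RL_minus \<alpha> (RL_const c)) = sup (lower_part \<alpha> c) (upper_part \<alpha> c)"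
  unfolding RL_minus_const[OF assms]
  by (simp add: real_cuts.coz_cut_hom[OF real_cuts_translate[OF assms]])

text \<open>The two parts are always disjoint. By \<open>coz_minus_const\<close>, r lies outside
  \<open>R_set \<alpha>\<close> exactly when they also join to \<open>top\<close>.\<close>

lemma complements_parts:
  assumes "\<alpha> \<in> RL" "r \<notin> R_set \<alpha>"
  shows "complements (upper_part \<alpha> r) (lower_part \<alpha> r)"
  using assms by (simp add: R_set_def coz_minus_const complements_def upper_inf_lower sup.commute)

section \<open>Countable joins of complemented elements\<close>

definition sigma_complemented :: "'a::frame set" where
  "sigma_complemented = {Sup S | S. countable S \<and> (\<forall>x\<in>S. \<exists>y. complements x y)}"

lemma sigma_complementedI:
  "countable S \<Longrightarrow> (\<And>x. x \<in> S \<Longrightarrow> \<exists>y. complements x y) \<Longrightarrow> Sup S \<in> sigma_complemented"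
  unfolding sigma_complemented_def by blast

lemma complemented_in_sigma_complemented: "complements x y \<Longrightarrow> x \<in> sigma_complemented"
  using sigma_complementedI[of "{x}"] by auto

lemma complements_top_bot: "complements top bot"
  by (simp add: complements_def)

lemma complements_bot_top: "complements bot top"
  by (simp add: complements_def)

lemma sigma_complemented_Sup:
  assumes "countable S" "S \<subseteq> sigma_complemented"
  shows "Sup S \<in> sigma_complemented"
proof -
  have "\<exists>T. x = Sup T \<and> countable T \<and> (\<forall>y\<in>T. \<exists>z. complements y z)" if "x \<in> S" for x
    using assms(2) that unfolding sigma_complemented_def by blast
  then obtain T where T: "\<And>x. x \<in> S \<Longrightarrow> x = Sup (T x)" "\<And>x. x \<in> S \<Longrightarrow> countable (T x)"
    "\<And>x y. x \<in> S \<Longrightarrow> y \<in> T x \<Longrightarrow> \<exists>z. complements y z"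
    by metis
  have "Sup S = Sup (\<Union>x\<in>S. T x)"
    unfolding Sup_UN using T(1) by simp
  also have "\<dots> \<in> sigma_complemented"
    using assms(1) T(2,3) by (intro sigma_complementedI) auto
  finally show ?thesis .
qed

lemma sigma_complemented_inf:
  assumes "a \<in> sigma_complemented" "b \<in> sigma_complemented"
  shows "inf a b \<in> sigma_complemented"
proof -
  obtain S T where S: "a = Sup S" "countable S" "\<forall>x\<in>S. \<exists>z. complements x z"
    and T: "b = Sup T" "countable T" "\<forall>x\<in>T. \<exists>z. complements x z"
    using assms unfolding sigma_complemented_def by blast
  let ?U = "(\<lambda>(x, y). inf x y) ` (S \<times> T)"
  have "inf a b = Sup ?U"
  proof (rule antisym)
    show "inf a b \<le> Sup ?U"
      unfolding S(1) T(1) by (rule inf_Sup_Sup_le) (auto intro: SUP_upper2)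
    show "Sup ?U \<le> inf a b"
      unfolding S(1) T(1) by (rule SUP_least) (auto intro: le_infI1 le_infI2 Sup_upper)
  qed
  also have "\<dots> \<in> sigma_complemented"
    using S(2,3) T(2,3) by (intro sigma_complementedI) (auto dest!: bspec intro: complements_inf)
  finally show ?thesis .
qed

text \<open>The finite partial joins of an enumeration are complemented, increasing, and have the
  same join as the whole family.\<close>

lemma sigma_complemented_sequence:
  fixes a :: "'a::frame"
  assumes "a \<in> sigma_complemented"
  obtains e k :: "nat \<Rightarrow> 'a" where "\<And>n. complements (e n) (k n)" "mono e" "e 0 = bot" "a = Sup (range e)"
proof -
  obtain S where S: "a = Sup S" "countable S" "\<forall>x\<in>S. \<exists>z. complements x z"
    using assms unfolding sigma_complemented_def by blast
  \<comment> \<open>Adjoining \<open>bot\<close> makes the set nonempty, so that it is the range of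
    a sequence, and leaves the join unchanged.\<close>
  define c where "c = from_nat_into (insert bot S)"
  have range_c: "range c = insert bot S"
    unfolding c_def using S(2) by (intro range_from_nat_into) auto
  have c: "\<exists>z. complements (c n) z" for n
  proof -
    have "c n \<in> insert bot S"
      using range_c by blast
    then show ?thesis
      using S(3) complements_bot_top by auto
  qed
  \<comment> \<open>The strict bound makes \<open>e 0\<close> an empty join, which yields
    \<open>e 0 = bot\<close>.\<close>
  define e where "e n = Sup (c ` {..<n})" for n
  have "\<exists>z. complements (e n) z" for n
  proof (induction n)
    case 0
    show ?case
      using complements_bot_top by (auto simp: e_def)
  next
    case (Suc n)
    have "e (Suc n) = sup (c n) (e n)"
      by (simp add: e_def lessThan_Suc)
    then show ?case
      using Suc c[of n] complements_sup by metis
  qed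
  then obtain k where "\<And>n. complements (e n) (k n)"
    by metis
  moreover have "mono e"
    unfolding e_def by (intro monoI SUP_subset_mono) auto
  moreover have "e 0 = bot"
    by (simp add: e_def)
  moreover have "a = Sup (range e)"
  proof -
    have "range c = (\<Union>n. c ` {..<n})"
      by (auto simp: image_def)
    then have "Sup (range c) = Sup (range e)"
      by (simp add: e_def Sup_UN)
    then show ?thesis
      by (simp add: range_c S(1))
  qed
  ultimately show thesis
    by (rule that)
qed

section \<open>Cozero elements as countable joins of complemented elements\<close>

lemma countable_avoid:
  fixes R :: "real set"
  assumes "countable R" "x < y"
  obtains r where "x < r" "r < y" "r \<notin> R"
proof -
  have "uncountable ({x<..<y} - R)"
    using assms by (intro uncountable_minus_countable) (auto simp: uncountable_open_interval)
  then have "{x<..<y} - R \<noteq> {}"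
    by (metis countable_empty)
  then show thesis
    using that by fastforce
qed

lemma coz_C_c_sigma_complemented:
  assumes "\<alpha> \<in> C_c"
  shows "coz \<alpha> \<in> sigma_complemented"
proof -
  have \<alpha>: "\<alpha> \<in> RL" and R: "countable (R_set \<alpha>)"
    using assms by (simp_all add: C_c_def)
  \<comment> \<open>One good point is chosen per rational endpoint, so the resulting family of
    complemented elements is countable and still dominates every generator value in the two parts at
    0.\<close>
  have "\<exists>r. 0 < r \<and> r < of_rat a \<and> r \<notin> R_set \<alpha>" if "0 < (of_rat a :: real)" for a
    using countable_avoid[OF R that] by blast
  then obtain r where r: "\<And>a. 0 < (of_rat a :: real) \<Longrightarrow> 0 < r a \<and> r a < of_rat a \<and> r a \<notin> R_set \<alpha>"
    by metis
  have "\<exists>s. of_rat b < s \<and> s < 0 \<and> s \<notin> R_set \<alpha>" if "(of_rat b :: real) < 0" for b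
    using countable_avoid[OF R that] by blast
  then obtain s where s: "\<And>b. (of_rat b :: real) < 0 \<Longrightarrow> of_rat b < s b \<and> s b < 0 \<and> s b \<notin> R_set \<alpha>"
    by metis
  let ?A = "{a. 0 < (of_rat a :: real)}" and ?B = "{b. (of_rat b :: real) < 0}"
  let ?S = "(\<lambda>a. upper_part \<alpha> (r a)) ` ?A \<union> (\<lambda>b. lower_part \<alpha> (s b)) ` ?B"
  have "coz \<alpha> = Sup ?S"
    unfolding coz_parts[OF \<alpha>]
  proof (rule antisym)
    show "sup (lower_part \<alpha> 0) (upper_part \<alpha> 0) \<le> Sup ?S"
    proof (rule sup_least)
      show "lower_part \<alpha> 0 \<le> Sup ?S"
        unfolding lower_part_def[of \<alpha> 0]
      proof (rule Sup_least, clarify)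
        fix a b
        assume b: "of_rat b < (0::real)"
        then have "\<alpha> (real_gen a b) \<le> lower_part \<alpha> (s b)"
          using s by (intro lower_part_upper) blast
        also have "\<dots> \<le> Sup ?S"
          using b by (intro Sup_upper) blast
        finally show "\<alpha> (real_gen a b) \<le> Sup ?S" .
      qed
      show "upper_part \<alpha> 0 \<le> Sup ?S"
        unfolding upper_part_def[of \<alpha> 0]
      proof (rule Sup_least, clarify)
        fix a b
        assume a: "(0::real) < of_rat a"
        then have "\<alpha> (real_gen a b) \<le> upper_part \<alpha> (r a)"
          using r by (intro upper_part_upper) blast
        also have "\<dots> \<le> Sup ?S"
          using a by (intro Sup_upper) blast
        finally show "\<alpha> (real_gen a b) \<le> Sup ?S" .
      qed
    qed
    have "upper_part \<alpha> (r a) \<le> upper_part \<alpha> 0" if "a \<in> ?A" for a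
      using r[of a] that by (intro upper_part_anti) simp
    moreover have "lower_part \<alpha> (s b) \<le> lower_part \<alpha> 0" if "b \<in> ?B" for b
      using s[of b] that by (intro lower_part_mono) simp
    ultimately show "Sup ?S \<le> sup (lower_part \<alpha> 0) (upper_part \<alpha> 0)"
      by (intro Sup_least) (blast intro: le_supI1 le_supI2)
  qed
  also have "\<dots> \<in> sigma_complemented"
  proof (rule sigma_complementedI)
    show "countable ?S"
      by simp
    fix x
    assume "x \<in> ?S"
    then consider a where "a \<in> ?A" "x = upper_part \<alpha> (r a)" | b where "b \<in> ?B" "x = lower_part \<alpha> (s b)"
      by blast
    then show "\<exists>y. complements x y"
      using r s complements_parts[OF \<alpha>] complements_sym by cases blast+
  qed
  finally show ?thesis .
qed

section \<open>Countable joins of complemented elements as cozero elements\<close>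

lemma ex_reciprocal_bracket:
  fixes x :: "'a::archimedean_field"
  assumes "0 < x"
  shows "\<exists>n. 1 / of_nat (Suc n) < x \<and> (n = 0 \<or> x \<le> 1 / of_nat n)"
proof -
  have ex: "\<exists>n. 1 / of_nat (Suc n) < x"
    using reals_Archimedean[OF assms] by (auto simp: inverse_eq_divide)
  \<comment> \<open>Minimality gives the upper bound when n is positive. The case n = 0 covers x >
    1, where no reciprocal lies above x.\<close>
  define n where "n = (LEAST n. 1 / of_nat (Suc n) < x)"
  have "1 / of_nat (Suc n) < x"
    unfolding n_def using ex by (rule LeastI_ex)
  moreover have "x \<le> 1 / of_nat n" if "n = Suc m" for m
  proof -
    have "\<not> 1 / of_nat (Suc m) < x"
      using that unfolding n_def by (intro not_less_Least) simp
    then show ?thesis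
      by (simp add: that not_less)
  qed
  ultimately show ?thesis
    by (cases n) blast+
qed

text \<open>The witness takes the value \<open>1/(n+1)\<close> on \<open>e (n+1) \<and> k n\<close> and \<open>0\<close> off every \<open>e n\<close>. Since
  \<open>1 / of_nat 0 = 0\<close>, the term \<open>n = 0\<close> never contributes to \<open>U p\<close> for \<open>p \<ge> 0\<close>.\<close>

lemma sigma_complemented_coz:
  fixes a :: "'a::frame"
  assumes "a \<in> sigma_complemented"
  shows "\<exists>\<alpha>\<in>C_c. coz \<alpha> = a"
proof -
  obtain e k :: "nat \<Rightarrow> 'a" where compl: "\<And>n. complements (e n) (k n)" and "mono e" and e0: "e 0 = bot"
    and a: "a = Sup (range e)"
    using sigma_complemented_sequence[OF assms] by blast
  have e_mono: "m \<le> n \<Longrightarrow> e m \<le> e n" for m n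
    using \<open>mono e\<close> by (rule monoD)
  have k0: "k 0 = top"
    using compl[of 0] by (simp add: complements_def e0)
  \<comment> \<open>For positive n, \<open>e n\<close> is where the function is at least 1/n;
    \<open>k n\<close> is where it is at most 1/(n+1). The function is nonnegative, hence
    \<open>top\<close> below 0.\<close>
  define U where "U p = (if p < 0 then top else Sup {e n | n. p < 1 / of_nat n})" for p :: rat
  define V where "V q = Sup {k n | n. 1 / of_nat (Suc n) < q}" for q :: rat
  have U_upper: "e n \<le> U p" if "p < 1 / of_nat n" for n p
    unfolding U_def using that by (auto intro: Sup_upper)
  have U_neg: "U p = top" if "p < 0" for p
    using that by (simp add: U_def)
  have U_le: "U p \<le> b" if "0 \<le> p" "\<And>n. p < 1 / of_nat n \<Longrightarrow> e n \<le> b" for p b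
    using that unfolding U_def by (auto intro: Sup_least)
  have V_upper: "k n \<le> V q" if "1 / of_nat (Suc n) < q" for n q
    unfolding V_def using that by (intro Sup_upper) blast
  have V_le: "V q \<le> b" if "\<And>n. 1 / of_nat (Suc n) < q \<Longrightarrow> k n \<le> b" for q b
    using that unfolding V_def by (auto intro: Sup_least)
  have V_nonpos: "V q = bot" if "q \<le> 0" for q
  proof -
    have "\<not> 1 / of_nat (Suc n) < q" for n
      using that by (meson less_le_trans not_less of_nat_0_le_iff zero_le_divide_1_iff)
    then have "V q \<le> bot"
      by (intro V_le) blast
    then show ?thesis
      by (rule bot.extremum_uniqueI)
  qed
  interpret real_cuts U V
  proof
    fix p q :: rat
    show "U q \<le> U p" if "p \<le> q"
    proof (cases "p < 0")
      case False
      then show ?thesis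
        using that by (intro U_le U_upper) auto
    qed (simp add: U_neg)
    show "V p \<le> V q" if "p \<le> q"
      using that by (intro V_le V_upper) auto
    show "inf (U p) (V q) = bot" if "q \<le> p"
    proof (cases "p < 0")
      case True
      then show ?thesis
        using that by (simp add: V_nonpos)
    next
      case False
      have "inf (U p) (V q) = inf (Sup {e n | n. p < 1 / of_nat n}) (Sup {k n | n. 1 / of_nat (Suc n) < q})"
        using False by (simp add: U_def V_def)
      also have "\<dots> \<le> bot"
      proof (rule inf_Sup_Sup_le, clarify)
        fix m n
        assume "p < 1 / of_nat m" "1 / of_nat (Suc n) < q"
        then have less: "1 / of_nat (Suc n) < (1 / of_nat m :: rat)"
          using that by linarith
        \<comment> \<open>Then \<open>e m\<close> lies below \<open>e n\<close>, which is disjoint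
          from \<open>k n\<close>.\<close>
        have "m \<le> n"
        proof (rule ccontr)
          assume "\<not> m \<le> n"
          then have "1 / of_nat m \<le> (1 / of_nat (Suc n) :: rat)"
            by (intro divide_left_mono) auto
          with less show False
            by simp
        qed
        then show "inf (e m) (k n) \<le> bot"
          using complements_disjoint[OF compl e_mono order_refl] by simp
      qed
      finally show ?thesis
        by (rule bot.extremum_uniqueI)
    qed
    show "sup (U p) (V q) = top" if "p < q"
    proof (cases "p < 0")
      case False
      then have "0 < q"
        using that by simp
      \<comment> \<open>This single n gives \<open>e n \<le> U p\<close> and
        \<open>k n \<le> V q\<close>, and \<open>e n\<close>, \<open>k n\<close> are complements.
        For n = 0 the first inequality holds because \<open>e 0\<close> is
        \<open>bot\<close>.\<close>
      then obtain n where n: "1 / of_nat (Suc n) < q" "n = 0 \<or> q \<le> 1 / of_nat n"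
        using ex_reciprocal_bracket by blast
      have "e n \<le> U p"
        using n(2) e0 that by (auto intro: U_upper)
      then show ?thesis
        using V_upper[OF n(1)] by (rule complements_cover[OF compl])
    qed (simp add: U_neg)
    show "U p \<le> Sup {U r | r. p < r}" (is "_ \<le> ?S")
    proof (cases "p < 0")
      case True
      then obtain r where r: "p < r" "r < 0"
        using dense by blast
      then have "U r \<le> ?S"
        by (intro Sup_upper) blast
      then show ?thesis
        using r True by (simp add: U_neg)
    next
      case False
      show ?thesis
      proof (rule U_le)
        fix n
        assume "p < 1 / of_nat n"
        then obtain r where r: "p < r" "r < 1 / of_nat n"
          using dense by blast
        have "e n \<le> U r"
          using r(2) by (rule U_upper)
        also have "\<dots> \<le> ?S"
          using r(1) by (intro Sup_upper) blast
        finally show "e n \<le> ?S" .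
      qed (use False in simp)
    qed
    show "V q \<le> Sup {V s | s. s < q}" (is "_ \<le> ?S")
    proof (rule V_le)
      fix n
      assume "1 / of_nat (Suc n) < q"
      then obtain s where s: "1 / of_nat (Suc n) < s" "s < q"
        using dense by blast
      have "k n \<le> V s"
        using s(1) by (rule V_upper)
      also have "\<dots> \<le> ?S"
        using s(2) by (intro Sup_upper) blast
      finally show "k n \<le> ?S" .
    qed
    show "Sup (range U) = top"
      by (intro top_le SUP_upper2[of "-1"]) (simp_all add: U_neg)
    show "Sup (range V) = top"
      using V_upper[of 0 2] by (intro top_le SUP_upper2[of 2]) (simp_all add: k0)
  qed
  have "coz cut_hom = U 0"
    by (simp add: coz_cut_hom V_nonpos)
  also have "U 0 = a"
  proof (rule antisym)
    show "U 0 \<le> a"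
      unfolding a by (rule U_le) (auto intro: SUP_upper)
    show "a \<le> U 0"
      unfolding a
    proof (rule SUP_least)
      fix n
      show "e n \<le> U 0"
        by (cases "n = 0") (auto simp: e0 intro: U_upper)
    qed
  qed
  finally have "coz cut_hom = a" .
  moreover have "cut_hom \<in> C_c"
  proof -
    \<comment> \<open>Only the values 1/n and 0 can lie in \<open>R_set\<close>; 0 belongs to this
      range as the term n = 0. At any other r a complementary pair lies below the two parts.\<close>
    have "r \<in> range (\<lambda>n. 1 / of_nat n)" if "r \<in> R_set cut_hom" for r
    proof (rule ccontr)
      assume r: "r \<notin> range (\<lambda>n. 1 / of_nat n)"
      have "sup (lower_part cut_hom r) (upper_part cut_hom r) = top"
      proof (cases "r < 0")
        case True
        then obtain p where "r < of_rat p" "of_rat p < (0::real)"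
          using of_rat_dense by blast
        then have "upper_part cut_hom r = top"
          using U_le_upper_part[of r p] by (intro top_le) (simp add: U_neg)
        then show ?thesis
          by simp
      next
        case False
        have "r \<noteq> 1 / of_nat n" for n
          using r by blast
        from this[of 0] False have "0 < r"
          by simp
        then obtain n where n: "1 / of_nat (Suc n) < r" "n = 0 \<or> r \<le> 1 / of_nat n"
          using ex_reciprocal_bracket by blast
        have "e n \<le> upper_part cut_hom r"
        proof (cases "n = 0")
          case False
          \<comment> \<open>Since r is not a reciprocal the inequality is strict, which leaves room
            for a rational p.\<close>
          then have "r < 1 / of_nat n"
            using n(2) \<open>r \<noteq> 1 / of_nat n\<close> by simp
          then obtain p where p: "r < of_rat p" "of_rat p < (1 / of_nat n :: real)"
            using of_rat_dense by blast
          have "(of_rat p :: real) < of_rat (1 / of_nat n)"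
            using p(2) by (simp add: of_rat_divide)
          then have "e n \<le> U p"
            by (intro U_upper) (simp only: of_rat_less)
          also have "\<dots> \<le> upper_part cut_hom r"
            using p(1) by (rule U_le_upper_part)
          finally show ?thesis .
        qed (simp add: e0)
        moreover have "k n \<le> lower_part cut_hom r"
        proof -
          obtain q where q: "1 / of_nat (Suc n) < (of_rat q :: real)" "of_rat q < r"
            using of_rat_dense[OF n(1)] by blast
          have "of_rat (1 / of_nat (Suc n)) < (of_rat q :: real)"
            using q(1) by (simp only: of_rat_divide of_rat_of_nat_eq of_rat_1)
          then have "k n \<le> V q"
            by (intro V_upper) (simp only: of_rat_less)
          also have "\<dots> \<le> lower_part cut_hom r"
            using q(2) by (rule V_le_lower_part)
          finally show ?thesis .
        qed
        ultimately show ?thesis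
          using complements_cover[OF complements_sym[OF compl]] by blast
      qed
      then show False
        using that by (simp add: R_set_def coz_minus_const[OF cut_hom(1)])
    qed
    then have "R_set cut_hom \<subseteq> range (\<lambda>n. 1 / of_nat n)"
      by blast
    then have "countable (R_set cut_hom)"
      by (rule countable_subset) simp
    then show ?thesis
      by (simp add: C_c_def cut_hom(1))
  qed
  ultimately show ?thesis
    by blast
qed

lemma coz_image_C_c: "coz ` C_c = sigma_complemented"
  using coz_C_c_sigma_complemented sigma_complemented_coz by blast

section \<open>Sub-\<open>\<sigma>\<close>-frames of a frame\<close>

text \<open>The operations of the ordered record are chosen least or greatest elements. Closure of
  \<open>K\<close> makes them agree with the frame operations, so the frame laws carry over.\<close>

locale sub_sigma_frame =
  fixes K :: "'a::frame set"
  assumes top_closed: "top \<in> K"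
    and inf_closed: "a \<in> K \<Longrightarrow> b \<in> K \<Longrightarrow> inf a b \<in> K"
    and Sup_closed: "countable S \<Longrightarrow> S \<subseteq> K \<Longrightarrow> Sup S \<in> K"
begin

definition ord :: "'a gorder" where
  "ord = \<lparr>carrier = K, eq = (=), le = (\<le>)\<rparr>"

lemma ord_simps [simp]: "carrier ord = K" "le ord = (\<le>)" "eq ord = (=)"
  by (simp_all add: ord_def)

lemma bot_closed: "bot \<in> K"
  using Sup_closed[of "{}"] by simp

lemma sup_closed: "a \<in> K \<Longrightarrow> b \<in> K \<Longrightarrow> sup a b \<in> K"
  using Sup_closed[of "{a, b}"] by simp

lemma least_Sup:
  assumes "countable S" "S \<subseteq> K"
  shows "least ord (Sup S) (Upper ord S)"
  using assms by (auto simp: least_def Upper_def intro: Sup_upper Sup_least Sup_closed)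

lemma least_unique: "least ord x A \<Longrightarrow> least ord y A \<Longrightarrow> x = y"
  by (auto simp: least_def intro: antisym)

lemma greatest_unique: "greatest ord x A \<Longrightarrow> greatest ord y A \<Longrightarrow> x = y"
  by (auto simp: greatest_def intro: antisym)

lemma Sup_ord: "countable S \<Longrightarrow> S \<subseteq> K \<Longrightarrow> \<Squnion>\<^bsub>ord\<^esub>S = Sup S"
  unfolding Lattice.sup_def by (blast intro: some_equality least_Sup least_unique)

lemma join_ord: "a \<in> K \<Longrightarrow> b \<in> K \<Longrightarrow> a \<squnion>\<^bsub>ord\<^esub> b = sup a b"
  unfolding join_def by (simp add: Sup_ord)

lemma greatest_inf:
  "a \<in> K \<Longrightarrow> b \<in> K \<Longrightarrow> greatest ord (inf a b) (Lower ord {a, b})"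
  by (auto simp: greatest_def Lower_def intro: inf_closed)

lemma meet_ord: "a \<in> K \<Longrightarrow> b \<in> K \<Longrightarrow> a \<sqinter>\<^bsub>ord\<^esub> b = inf a b"
  unfolding meet_def Lattice.inf_def by (blast intro: some_equality greatest_inf greatest_unique)

lemma greatest_top: "greatest ord top K"
  by (auto simp: greatest_def top_closed)

lemma least_bot: "least ord bot K"
  by (auto simp: least_def bot_closed)

lemma top_ord: "\<top>\<^bsub>ord\<^esub> = top"
  unfolding Order.top_def ord_simps by (blast intro: some_equality greatest_top greatest_unique)

lemma bottom_ord: "\<bottom>\<^bsub>ord\<^esub> = bot"
  unfolding Order.bottom_def ord_simps by (blast intro: some_equality least_bot least_unique)

lemma bounded_lattice_ord: "bounded_lattice ord"
proof
  show "\<exists>s. least ord s (Upper ord {x, y})" if "x \<in> carrier ord" "y \<in> carrier ord" for x y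
    using least_Sup[of "{x, y}"] that by auto
  show "\<exists>s. greatest ord s (Lower ord {x, y})" if "x \<in> carrier ord" "y \<in> carrier ord" for x y
    using greatest_inf[of x y] that by auto
  show "\<exists>x. least ord x (carrier ord)" "\<exists>x. greatest ord x (carrier ord)"
    using least_bot greatest_top by auto
qed auto

lemma countable_joins_ord: "countable_joins ord"
  unfolding countable_joins_def using least_Sup by auto

lemma sigma_lattice_ord: "sigma_lattice ord"
  by (simp add: sigma_lattice_def bounded_lattice_ord countable_joins_ord)

lemma sigma_frame_ord: "sigma_frame ord"
  unfolding sigma_frame_def
proof (intro conjI ballI allI impI)
  show "lattice ord"
    using bounded_lattice_ord by (rule bounded_lattice.axioms)
  show "countable_joins ord"
    by (rule countable_joins_ord)
  show "a \<sqinter>\<^bsub>ord\<^esub> (b \<squnion>\<^bsub>ord\<^esub> c) = (a \<sqinter>\<^bsub>ord\<^esub> b) \<squnion>\<^bsub>ord\<^esub> (a \<sqinter>\<^bsub>ord\<^esub> c)"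
    if "a \<in> carrier ord" "b \<in> carrier ord" "c \<in> carrier ord" for a b c
    using that by (simp add: join_ord meet_ord inf_closed sup_closed frame_inf_sup)
  fix a S
  assume a: "a \<in> carrier ord" and S: "S \<subseteq> carrier ord \<and> countable S"
  have "(\<lambda>s. a \<sqinter>\<^bsub>ord\<^esub> s) ` S = (\<lambda>s. inf a s) ` S"
    using a S by (intro image_cong) (auto simp: meet_ord)
  moreover have "\<Squnion>\<^bsub>ord\<^esub>((\<lambda>s. inf a s) ` S) = Sup ((\<lambda>s. inf a s) ` S)"
    using a S by (intro Sup_ord) (auto intro: inf_closed)
  moreover have "a \<sqinter>\<^bsub>ord\<^esub> (\<Squnion>\<^bsub>ord\<^esub>S) = inf a (Sup S)"
    using a S by (simp add: Sup_ord meet_ord Sup_closed)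
  ultimately show "a \<sqinter>\<^bsub>ord\<^esub> (\<Squnion>\<^bsub>ord\<^esub>S) = \<Squnion>\<^bsub>ord\<^esub>((\<lambda>s. a \<sqinter>\<^bsub>ord\<^esub> s) ` S)"
    by (simp add: inf_Sup)
qed

end

section \<open>Normality and the Alexandroff property of the cozero elements\<close>

interpretation coz: sub_sigma_frame "sigma_complemented :: 'a::frame set"
  by unfold_locales
    (auto intro: sigma_complemented_inf sigma_complemented_Sup
      complemented_in_sigma_complemented complements_top_bot)

lemma Coz_c_eq: "Coz_c = coz.ord"
  by (simp add: Coz_c_def coz.ord_def coz_image_C_c)

text \<open>The separating elements are obtained by disjointing the two increasing sequences against
  each other.\<close>

lemma sigma_complemented_normal:
  fixes a :: "'a::frame"
  assumes "a \<in> sigma_complemented" "b \<in> sigma_complemented" "sup a b = top"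
  shows "\<exists>u\<in>sigma_complemented. \<exists>v\<in>sigma_complemented.
    sup a u = top \<and> sup v b = top \<and> inf u v = bot"
proof -
  obtain e k :: "nat \<Rightarrow> 'a" where e: "\<And>n. complements (e n) (k n)" "mono e" "a = Sup (range e)"
    using sigma_complemented_sequence[OF assms(1)] by blast
  obtain f l :: "nat \<Rightarrow> 'a" where f: "\<And>n. complements (f n) (l n)" "mono f" "b = Sup (range f)"
    using sigma_complemented_sequence[OF assms(2)] by blast
  define u where "u = (SUP n. inf (k n) (f n))"
  define v where "v = (SUP n. inf (l n) (e n))"
  have "u \<in> sigma_complemented" "v \<in> sigma_complemented"
    unfolding u_def v_def
    using complements_inf[OF complements_sym[OF e(1)] f(1)]
      complements_inf[OF complements_sym[OF f(1)] e(1)]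
    by (force intro: sigma_complementedI)+
  moreover have "sup a u = top"
  proof -
    have "f n \<le> sup a u" for n
    proof -
      have "f n \<le> sup (e n) (inf (k n) (f n))"
        by (rule complements_le[OF e(1)])
      also have "\<dots> \<le> sup a u"
        unfolding e(3) u_def by (intro sup_mono SUP_upper) simp_all
      finally show ?thesis .
    qed
    then have "sup a b \<le> sup a u"
      unfolding f(3) by (intro sup_least SUP_least) simp_all
    then show ?thesis
      by (simp add: assms(3) top_le)
  qed
  moreover have "sup v b = top"
  proof -
    have "e n \<le> sup v b" for n
    proof -
      have "e n \<le> sup (f n) (inf (l n) (e n))"
        by (rule complements_le[OF f(1)])
      also have "\<dots> \<le> sup b v"
        unfolding f(3) v_def by (intro sup_mono SUP_upper) simp_all
      finally show ?thesis
        by (simp add: sup.commute)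
    qed
    then have "sup a b \<le> sup v b"
      unfolding e(3) by (intro sup_least SUP_least) simp_all
    then show ?thesis
      by (simp add: assms(3) top_le)
  qed
  moreover have "inf u v = bot"
  proof -
    \<comment> \<open>The larger index decides: for \<open>m \<le> n\<close>, \<open>f m\<close>
      lies below \<open>f n\<close> and so misses \<open>l n\<close>; otherwise \<open>e n\<close>
      lies below \<open>e m\<close> and so misses \<open>k m\<close>.\<close>
    have "inf (inf (k m) (f m)) (inf (l n) (e n)) \<le> bot" for m n
    proof (cases "m \<le> n")
      case True
      have "inf (inf (k m) (f m)) (inf (l n) (e n)) = bot"
        using monoD[OF f(2) True] by (intro complements_disjoint[OF f(1)[of n]]) (auto intro: le_infI2)
      then show ?thesis
        by simp
    next
      case False
      then have "inf (inf (k m) (f m)) (inf (l n) (e n)) = bot"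
        using monoD[OF e(2), of n m]
        by (intro complements_disjoint[OF complements_sym[OF e(1)], of _ m]) (auto intro: le_infI2)
      then show ?thesis
        by simp
    qed
    then have "inf u v \<le> bot"
      unfolding u_def v_def by (intro inf_Sup_Sup_le) blast
    then show ?thesis
      by (rule bot.extremum_uniqueI)
  qed
  ultimately show ?thesis
    by blast
qed

theorem corollary6p8:
  assumes "completely_regular TYPE('a::frame)"
  shows "sigma_frame (Coz_c :: 'a gorder) \<and> alexandroff_algebra (Coz_c :: 'a gorder)"
  unfolding Coz_c_eq alexandroff_algebra_def
proof (intro conjI ballI)
  show "sigma_frame (coz.ord :: 'a gorder)"
    by (rule coz.sigma_frame_ord)
  show "sigma_lattice (coz.ord :: 'a gorder)"
    by (rule coz.sigma_lattice_ord)
  show "normal_lattice (coz.ord :: 'a gorder)"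
    unfolding normal_lattice_def
  proof (intro conjI ballI impI)
    show "bounded_lattice (coz.ord :: 'a gorder)"
      by (rule coz.bounded_lattice_ord)
    fix a b :: 'a
    assume ab: "a \<in> carrier coz.ord" "b \<in> carrier coz.ord" "a \<squnion>\<^bsub>coz.ord\<^esub> b = \<top>\<^bsub>coz.ord\<^esub>"
    then obtain u v where "u \<in> sigma_complemented" "v \<in> sigma_complemented"
      "sup a u = top" "sup v b = top" "inf u v = bot"
      using sigma_complemented_normal[of a b] by (auto simp: coz.join_ord coz.top_ord)
    then show "\<exists>u\<in>carrier coz.ord. \<exists>v\<in>carrier coz.ord. a \<squnion>\<^bsub>coz.ord\<^esub> u = \<top>\<^bsub>coz.ord\<^esub> \<and>
        v \<squnion>\<^bsub>coz.ord\<^esub> b = \<top>\<^bsub>coz.ord\<^esub> \<and> u \<sqinter>\<^bsub>coz.ord\<^esub> v = \<bottom>\<^bsub>coz.ord\<^esub>"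
      using ab by (intro bexI[of _ u] bexI[of _ v]) (simp_all add: coz.join_ord coz.meet_ord coz.top_ord coz.bottom_ord)
  qed
  fix a :: 'a
  assume "a \<in> carrier coz.ord"
  then have a: "a \<in> sigma_complemented"
    by simp
  obtain e k :: "nat \<Rightarrow> 'a" where e: "\<And>n. complements (e n) (k n)" "a = Sup (range e)"
    using sigma_complemented_sequence[OF a] by blast
  have K: "e n \<in> sigma_complemented" "k n \<in> sigma_complemented" for n
    using e(1) complements_sym complemented_in_sigma_complemented by blast+
  \<comment> \<open>The Alexandroff pairs are \<open>e n\<close> with its complement
    \<open>k n\<close>, which joins with \<open>a\<close> to \<open>top\<close> because
    \<open>e n \<le> a\<close>.\<close>
  have "sup (k n) a = top" for n
    unfolding e(2) by (rule complements_cover[OF complements_sym[OF e(1)[of n]]]) (auto intro: SUP_upper)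
  moreover have "inf (k n) (e n) = bot" for n
    using complements_sym[OF e(1)] by (simp add: complements_def)
  moreover have "\<Squnion>\<^bsub>coz.ord\<^esub>(range e) = a"
    using K by (subst coz.Sup_ord) (auto simp: e(2))
  ultimately show "\<exists>x y. (\<forall>n::nat. x n \<in> carrier coz.ord \<and> y n \<in> carrier coz.ord \<and>
      y n \<squnion>\<^bsub>coz.ord\<^esub> a = \<top>\<^bsub>coz.ord\<^esub> \<and> y n \<sqinter>\<^bsub>coz.ord\<^esub> x n = \<bottom>\<^bsub>coz.ord\<^esub>) \<and>
      \<Squnion>\<^bsub>coz.ord\<^esub>(range x) = a"
    using a K by (intro exI[of _ e] exI[of _ k])
      (simp add: coz.join_ord coz.meet_ord coz.top_ord coz.bottom_ord)
qed

end
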